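(* Let $N\geq 3$ be an integer and $k\in\{1,2,\ldots,N\}$. Let $p:[0,\infty)\to(0,\infty)$ and $h:[0,\infty)\to[0,\infty)$ be continuous functions such that $h$ is monotone non-decreasing, $h(0)=0$, $h(s)>0$ for all $s>0$, and $$\int_{1}^{\infty}\frac{1}{\sqrt[k+1]{(k+1)H(t)}}\,dt=\infty,\qquad H(t)=\int_{0}^{t}h^{k}(z)\,dz.$$ Consider the equation $$S_{k}^{1/k}\left(\lambda\left(D^{2}u\right)\right)=p(|x|)\,h(u)\quad\text{in }\mathbb{R}^{N}.\qquad( * )$$ (a) The equation $( * )$ has a nonnegative nontrivial entire radial solution $u\in\Phi^{k}(\mathbb{R}^{N})$. Suppose furthermore that $r^{N+\frac{N}{k}-2}p^{k}(r)$ is nondecreasing for large $r$. Then: (b) If $p$ satisfies $$\int_{0}^{\infty}\left(\frac{k}{t^{N-k}}\int_{0}^{t}\frac{s^{N-1}}{C_{N-1}^{k-1}}p^{k}(s)\,ds\right)^{1/k}dt=\infty,$$ then any nonnegative nontrivial radial solution $u\in\Phi^{k}(\mathbb{R}^{N})$ of $( * )$ is large. (c) Conversely, if $( * )$ has a nonnegative entire large radial solution $u\in\Phi^{k}(\mathbb{R}^{N})$, then one or both of the following hold: 1. $\displaystyle\int_{0}^{\infty}t^{1+\varepsilon+\frac{2(k-1)}{k+1}}\left(p(t)\right)^{\frac{2k}{k+1}}dt=\infty$ for every $\varepsilon>0$; 2. $k\in\{[N/2]+1,\ldots,N\}$ if $N$ is odd, or $k\in\{[N/2],\ldots,N\}$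 if $N$ is even.
   Context: $[\cdot]$ denotes the integer part and $C_{N-1}^{k-1}=\frac{(N-1)!}{(k-1)!(N-k)!}$. For a $C^{2}$ function $u$ on $\mathbb{R}^{N}$, $D^{2}u$ is its Hessian matrix and $\lambda(D^{2}u)=(\lambda_{1},\ldots,\lambda_{N})$ is the vector of eigenvalues of $D^{2}u$. For $j=1,\ldots,N$, $S_{j}(\lambda)=\sum_{1\leq i_{1}<\cdots<i_{j}\leq N}\lambda_{i_{1}}\cdots\lambda_{i_{j}}$ is the $j$-th elementary symmetric polynomial, and $S_{k}^{1/k}$ denotes $(S_k)^{1/k}$. The Gårding open cone is $\Gamma_{k}(N)=\{\lambda\in\mathbb{R}^{N} : S_{1}(\lambda)>0,\ldots,S_{k}(\lambda)>0\}$, and the space of admissible (strictly $k$-convex) functions is $\Phi^{k}(\mathbb{R}^{N})=\{u\in C^{2}(\mathbb{R}^{N}) : \lambda(D^{2}u(x))\in\Gamma_{k}(N)\text{ for all }x\in\mathbb{R}^{N}\}$. "Nondecreasing for large $r$" means nondecreasing on $[R,\infty)$ for some $R>0$. "Radial" means depending only on $|x|$; "entire" means defined on all of $\mathbb{R}^{N}$; "nontrivial" means not identically zero; a solution $u$ is "large" if $u(x)\to\infty$ as $|x|\to\infty$. *)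

theory Defs
  imports "HOL-Analysis.Analysis"
begin

definition partial_deriv :: "'n \<Rightarrow> (real^'n \<Rightarrow> real) \<Rightarrow> real^'n \<Rightarrow> real" where
  "partial_deriv i f x = frechet_derivative f (at x) (axis i 1)"

definition C1_fun :: "(real^'n \<Rightarrow> real) \<Rightarrow> bool" where
  "C1_fun f \<longleftrightarrow> (\<forall>x. f differentiable (at x)) \<and> (\<forall>i. continuous_on UNIV (partial_deriv i f))"

definition C2_fun :: "(real^'n \<Rightarrow> real) \<Rightarrow> bool" where
  "C2_fun f \<longleftrightarrow> C1_fun f \<and> (\<forall>i. C1_fun (partial_deriv i f))"

definition hessian :: "(real^'n \<Rightarrow> real) \<Rightarrow> real^'n \<Rightarrow> real^'n^'n" where
  "hessian f x = (\<chi> i j. partial_deriv i (partial_deriv j f) x)"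

(* The eigenvalues with multiplicity, i.e. the roots of the characteristic polynomial, as a
   vector. Such a vector exists when A is symmetric (in particular for the Hessian of a C^2
   function) and is unique up to the order of its entries. The order is left unspecified:
   only symmetric functions of the entries are used. *)
definition eigenvalues :: "real^'n^'n \<Rightarrow> real^'n" where
  "eigenvalues A = (SOME l. \<forall>z. det (mat z - A) = (\<Prod>i\<in>UNIV. z - l $ i))"

(* The strictly increasing j-tuples of indices correspond to the j-element sets of indices. *)
definition elem_sym :: "nat \<Rightarrow> real^'n \<Rightarrow> real" where
  "elem_sym j l = (\<Sum>I | I \<subseteq> UNIV \<and> card I = j. \<Prod>i\<in>I. l $ i)"

definition garding_cone :: "nat \<Rightarrow> (real^'n) set" where
  "garding_cone k = {l. \<forall>j\<in>{1..k}. elem_sym j l > 0}"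

definition admissible :: "nat \<Rightarrow> (real^'n \<Rightarrow> real) set" where
  "admissible k = {u. C2_fun u \<and> (\<forall>x. eigenvalues (hessian u x) \<in> garding_cone k)}"

definition solves_hessian_eq ::
    "nat \<Rightarrow> (real \<Rightarrow> real) \<Rightarrow> (real \<Rightarrow> real) \<Rightarrow> (real^'n \<Rightarrow> real) \<Rightarrow> bool" where
  "solves_hessian_eq k p h u \<longleftrightarrow>
     (\<forall>x. root k (elem_sym k (eigenvalues (hessian u x))) = p (norm x) * h (u x))"

definition radial :: "(real^'n \<Rightarrow> real) \<Rightarrow> bool" where
  "radial u \<longleftrightarrow> (\<exists>f. \<forall>x. u x = f (norm x))"

definition large :: "(real^'n \<Rightarrow> real) \<Rightarrow> bool" where
  "large u \<longleftrightarrow> filterlim u at_top at_infinity"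

end

theory Submission
  imports Defs
begin

text \<open>For a radial function \<open>u(x) = \<phi>(|x|)\<close> the equation reads
  \<open>(r\<^bsup>N-k\<^esup> \<phi>'\<^sup>k)' = c r\<^bsup>N-1\<^esup> (p h(\<phi>))\<^sup>k\<close> with \<open>c = k / binom(N-1, k-1)\<close>.
  Let \<open>G\<close> be a primitive of \<open>((k+1) H)\<^bsup>-1/(k+1)\<^esup>\<close>; it is unbounded by hypothesis.

  (a) Since \<open>h\<close> is monotone, the Picard iterates starting from the constant 1 increase. Multiplying
  the equation by \<open>\<phi>'\<close> bounds \<open>G(\<phi>)\<close>, hence all iterates, on each \<open>[0,R]\<close>, and dominated
  convergence makes the limit a solution.

  (b) Admissibility forces \<open>\<phi> > 0\<close> and \<open>\<phi>' > 0\<close>, so \<open>h(\<phi>) \<ge> h(\<phi>(0)) > 0\<close>, and \<open>\<phi>'\<close> dominates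
  a positive multiple of the integrand of the divergent integral.

  (c) Negating alternative 2 gives \<open>2k < N\<close>. Multiplying the equation by \<open>r\<^bsup>N/k-1\<^esup> \<phi>'\<close>, integrating and
  using the monotonicity hypothesis gives
  \<open>(G(\<phi>))' \<le> A r\<^bsup>1-N/k\<^esup> + B r\<^bsup>(k-1)/(k+1)\<^esup> p\<^bsup>k/(k+1)\<^esup>\<close>. The first term is integrable
  because \<open>N > 2k\<close>; the second is bounded by AM-GM by the integrand of alternative 1 plus
  \<open>r\<^bsup>-1-\<epsilon>\<^esup>\<close>. If alternative 1 failed for some \<open>\<epsilon>\<close>, \<open>\<phi>\<close> would be bounded.\<close>

subsection \<open>Elementary symmetric functions of the eigenvalues\<close>

text \<open>Expanding the product chooses a set of indices, and grouping these sets by size produces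
  the coefficients. This generating polynomial is the bridge between \<open>elem_sym\<close> and
  characteristic polynomials.\<close>

lemma prod_one_plus_eq_elem_sym:
  fixes l :: "real^'n"
  shows "(\<Prod>i\<in>UNIV. 1 + t * l $ i) = (\<Sum>j\<le>CARD('n). elem_sym j l * t ^ j)"
proof -
  have "(\<Prod>i\<in>UNIV. 1 + t * l $ i) = (\<Prod>i\<in>UNIV. t * l $ i + 1)"
    by (simp add: add.commute)
  also have "\<dots> = (\<Sum>I\<in>Pow UNIV. (\<Prod>i\<in>I. t * l $ i) * (\<Prod>i\<in>UNIV - I. 1))"
    by (rule prod_add) simp
  also have "\<dots> = (\<Sum>I\<in>UNIV. (\<Prod>i\<in>I. l $ i) * t ^ card I)"
    by (simp add: prod.distrib mult.commute)
  also have "\<dots> = (\<Sum>j\<le>CARD('n). \<Sum>I | I \<in> UNIV \<and> card I = j. (\<Prod>i\<in>I. l $ i) * t ^ card I)"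
    by (rule sum.group[symmetric]) (auto simp: card_mono)
  also have "\<dots> = (\<Sum>j\<le>CARD('n). elem_sym j l * t ^ j)"
    by (simp add: elem_sym_def sum_distrib_right)
  finally show ?thesis .
qed

text \<open>Since \<open>eigenvalues\<close> is an unspecified choice, all that is known of it is
  its characteristic polynomial. Substituting z = -1/t turns that polynomial into the generating
  polynomial, whose coefficients are unique.\<close>

lemma elem_sym_cong_charpoly:
  fixes l m :: "real^'n"
  assumes "\<And>z. (\<Prod>i\<in>UNIV. z - l $ i) = (\<Prod>i\<in>UNIV. z - m $ i)"
  shows "elem_sym j l = elem_sym j m"
proof -
  have *: "(\<Prod>i\<in>UNIV. 1 + t * v $ i) = (- t) ^ CARD('n) * (\<Prod>i\<in>UNIV. (- (1 / t)) - v $ i)"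
    if "t \<noteq> 0" for t and v :: "real^'n"
  proof -
    have "(- t) ^ CARD('n) * (\<Prod>i\<in>UNIV. (- (1 / t)) - v $ i) = (\<Prod>i\<in>UNIV. (- t) * (- (1 / t) - v $ i))"
      by (simp only: prod.distrib prod_constant)
    also have "\<dots> = (\<Prod>i\<in>UNIV. 1 + t * v $ i)"
      using that by (intro prod.cong) (auto simp: algebra_simps)
    finally show ?thesis by simp
  qed
  have "(\<Prod>i\<in>UNIV. 1 + t * l $ i) = (\<Prod>i\<in>UNIV. 1 + t * m $ i)" for t
    by (cases "t = 0") (simp_all add: * assms)
  then have "\<forall>j\<le>CARD('n). elem_sym j l = elem_sym j m"
    unfolding prod_one_plus_eq_elem_sym polyfun_eq_coeffs[symmetric] by blast
  \<comment> \<open>Comparing coefficients reaches only j up to the dimension; beyond it both sums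
    are empty.\<close>
  moreover have "elem_sym j v = 0" if "j > CARD('n)" for v :: "real^'n"
  proof -
    have "card I \<noteq> j" for I :: "'n set"
      using that card_mono[of UNIV I] by simp
    then show ?thesis by (simp add: elem_sym_def)
  qed
  ultimately show ?thesis
    by (metis not_le)
qed

text \<open>A radial Hessian has this spectrum: one eigenvalue b in the radial direction and all
  others equal to a. The j-element index sets are split by whether they contain
  \<open>m\<close>.\<close>

lemma elem_sym_spike:
  fixes m :: "'n::finite"
  assumes "j \<ge> 1"
  shows "elem_sym j (\<chi> i. if i = m then b else a) =
    real ((CARD('n) - 1) choose (j - 1)) * b * a ^ (j - 1) + real ((CARD('n) - 1) choose j) * a ^ j"
proof -
  let ?l = "(\<chi> i. if i = m then b else a) :: real^'n"
  have S: "{I. card I = j} = insert m ` {I. I \<subseteq> UNIV - {m} \<and> card I = j - 1} \<union> {I. I \<subseteq> UNIV - {m} \<and> card I = j}"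
  proof (intro equalityI subsetI)
    fix I :: "'n set" assume I: "I \<in> {I. card I = j}"
    show "I \<in> insert m ` {I. I \<subseteq> UNIV - {m} \<and> card I = j - 1} \<union> {I. I \<subseteq> UNIV - {m} \<and> card I = j}"
    proof (cases "m \<in> I")
      case True
      then have "I = insert m (I - {m})" "card (I - {m}) = j - 1" using I by auto
      then show ?thesis by blast
    qed (use I in auto)
  qed (use assms in \<open>auto simp: card_insert_if\<close>)
  have "elem_sym j ?l = (\<Sum>I | card I = j. \<Prod>i\<in>I. ?l $ i)"
    by (simp add: elem_sym_def)
  also have "\<dots> = (\<Sum>I\<in>insert m ` {I. I \<subseteq> UNIV - {m} \<and> card I = j - 1}. \<Prod>i\<in>I. ?l $ i)
      + (\<Sum>I | I \<subseteq> UNIV - {m} \<and> card I = j. \<Prod>i\<in>I. ?l $ i)"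
    unfolding S by (rule sum.union_disjoint) auto
  also have "(\<Sum>I\<in>insert m ` {I. I \<subseteq> UNIV - {m} \<and> card I = j - 1}. \<Prod>i\<in>I. ?l $ i)
      = (\<Sum>I | I \<subseteq> UNIV - {m} \<and> card I = j - 1. \<Prod>i\<in>insert m I. ?l $ i)"
    by (rule sum.reindex_cong[where l = "insert m"]) (auto simp: inj_on_def)
  also have "\<dots> = (\<Sum>I | I \<subseteq> UNIV - {m} \<and> card I = j - 1. b * a ^ (j - 1))"
  proof (rule sum.cong[OF refl])
    fix I assume I: "I \<in> {I. I \<subseteq> UNIV - {m} \<and> card I = j - 1}"
    then have "(\<Prod>i\<in>I. ?l $ i) = (\<Prod>i\<in>I. a)" by (intro prod.cong) auto
    moreover have "m \<notin> I" using I by auto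
    ultimately show "(\<Prod>i\<in>insert m I. ?l $ i) = b * a ^ (j - 1)" using I by simp
  qed
  also have "(\<Sum>I | I \<subseteq> UNIV - {m} \<and> card I = j. \<Prod>i\<in>I. ?l $ i) = (\<Sum>I | I \<subseteq> UNIV - {m} \<and> card I = j. a ^ j)"
  proof (rule sum.cong[OF refl])
    fix I assume I: "I \<in> {I. I \<subseteq> UNIV - {m} \<and> card I = j}"
    then have "(\<Prod>i\<in>I. ?l $ i) = (\<Prod>i\<in>I. a)" by (intro prod.cong) auto
    then show "(\<Prod>i\<in>I. ?l $ i) = a ^ j" using I by simp
  qed
  finally show ?thesis
    by (simp add: n_subsets)
qed

text \<open>The matrix is a I + b x x^T. An orthogonal matrix sending the axis \<open>m\<close> to
  the direction of x diagonalises it, with the radial eigenvalue in position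
  \<open>m\<close>.\<close>

lemma charpoly_rank_one_update:
  fixes x :: "real^'n" and m :: 'n
  shows "det (mat z - (\<chi> i j. (if i = j then a else 0) + b * x $ i * x $ j)) =
    (\<Prod>i\<in>UNIV. z - (\<chi> i. if i = m then a + b * (norm x)\<^sup>2 else a) $ i)"
proof -
  \<comment> \<open>At x = 0 any orthogonal matrix serves, because the factor \<open>norm x\<close>
    vanishes; the identity is taken.\<close>
  obtain Q where Q: "orthogonal_matrix Q" "x = norm x *\<^sub>R (Q *v axis m 1)"
  proof (cases "x = 0")
    case True
    have "orthogonal_matrix (mat 1 :: real^'n^'n)" by (simp add: orthogonal_matrix_id)
    then show ?thesis using that True by simp
  next
    case False
    then have "norm (x /\<^sub>R norm x) = 1" by simp
    then obtain A where "orthogonal_matrix A" "A *v axis m 1 = x /\<^sub>R norm x"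
      using orthogonal_matrix_exists_basis by metis
    then show ?thesis using that False by simp
  qed
  define D :: "real^'n^'n" where
    "D = (\<chi> i j. if i = j then z - (if i = m then a + b * (norm x)\<^sup>2 else a) else 0)"
  have Qx: "x $ i = norm x * Q $ i $ m" for i
    by (subst Q(2)) (simp add: matrix_vector_mult_basis column_def)
  have QQ: "(\<Sum>l\<in>UNIV. Q $ i $ l * Q $ j $ l) = (if i = j then 1 else 0)" for i j
  proof -
    have "Q ** transpose Q = mat 1" using Q(1) by (simp add: orthogonal_matrix_def)
    then have "(Q ** transpose Q) $ i $ j = mat 1 $ i $ j" by simp
    then show ?thesis by (simp add: matrix_matrix_mult_def transpose_def mat_def)
  qed
  have "mat z - (\<chi> i j. (if i = j then a else 0) + b * x $ i * x $ j) = Q ** D ** transpose Q"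
  proof -
    have "(Q ** D ** transpose Q) $ i $ j = (mat z - (\<chi> i j. (if i = j then a else 0) + b * x $ i * x $ j)) $ i $ j" for i j
    proof -
      have "(Q ** D ** transpose Q) $ i $ j = (\<Sum>l\<in>UNIV. (\<Sum>r\<in>UNIV. Q $ i $ r * D $ r $ l) * Q $ j $ l)"
        by (simp add: matrix_matrix_mult_def transpose_def)
      also have "\<dots> = (\<Sum>l\<in>UNIV. Q $ i $ l * (z - (if l = m then a + b * (norm x)\<^sup>2 else a)) * Q $ j $ l)"
        by (simp add: D_def if_distrib[where f = "\<lambda>u. _ * u"] cong: if_cong)
      also have "\<dots> = (\<Sum>l\<in>UNIV. (z - a) * (Q $ i $ l * Q $ j $ l) - (if l = m then b * (norm x)\<^sup>2 * Q $ i $ l * Q $ j $ l else 0))"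
        by (intro sum.cong) (auto simp: algebra_simps)
      also have "\<dots> = (z - a) * (if i = j then 1 else 0) - b * x $ i * x $ j"
        by (simp add: sum_subtractf sum_distrib_left[symmetric] QQ) (simp add: Qx power2_eq_square)
      finally show ?thesis by (simp add: mat_def)
    qed
    then show ?thesis by (simp add: vec_eq_iff)
  qed
  then have "det (mat z - (\<chi> i j. (if i = j then a else 0) + b * x $ i * x $ j)) = (det Q * det (transpose Q)) * det D"
    by (simp add: det_mul)
  also have "det Q * det (transpose Q) = 1"
    using det_orthogonal_matrix[OF Q(1)] by auto
  also have "det D = (\<Prod>i\<in>UNIV. z - (\<chi> i. if i = m then a + b * (norm x)\<^sup>2 else a) $ i)"
    by (subst det_diagonal) (auto simp: D_def intro!: prod.cong)
  finally show ?thesis by simp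
qed

text \<open>The explicit spectrum witnesses the description in \<open>eigenvalues\<close>, so the
  choice has the right characteristic polynomial, and that polynomial determines every
  \<open>elem_sym j\<close>.\<close>

lemma elem_sym_eigenvalues_rank_one_update:
  fixes x :: "real^'n"
  assumes "j \<ge> 1"
  shows "elem_sym j (eigenvalues (\<chi> i j. (if i = j then a else 0) + b * x $ i * x $ j)) =
    real ((CARD('n) - 1) choose (j - 1)) * (a + b * (norm x)\<^sup>2) * a ^ (j - 1)
    + real ((CARD('n) - 1) choose j) * a ^ j"
proof -
  let ?A = "(\<chi> i j. (if i = j then a else 0) + b * x $ i * x $ j) :: real^'n^'n"
  fix m :: 'n
  let ?l = "(\<chi> i. if i = m then a + b * (norm x)\<^sup>2 else a) :: real^'n"
  have l: "\<forall>z. det (mat z - ?A) = (\<Prod>i\<in>UNIV. z - ?l $ i)"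
    using charpoly_rank_one_update by blast
  then have "\<forall>z. det (mat z - ?A) = (\<Prod>i\<in>UNIV. z - eigenvalues ?A $ i)"
    unfolding eigenvalues_def by (rule someI)
  then have "elem_sym j (eigenvalues ?A) = elem_sym j ?l"
    using l by (intro elem_sym_cong_charpoly) metis
  then show ?thesis by (simp add: elem_sym_spike[OF assms])
qed

subsection \<open>Hessians of radial functions\<close>

lemma partial_deriv_eqI:
  "(f has_derivative D) (at x) \<Longrightarrow> partial_deriv i f x = D (axis i 1)"
  by (simp add: partial_deriv_def frechet_derivative_at[symmetric])

lemma has_derivative_radial:
  fixes x :: "'a::real_inner"
  assumes "x \<noteq> 0" and "(\<phi> has_real_derivative d) (at (norm x))"
  shows "((\<lambda>y. \<phi> (norm y)) has_derivative (\<lambda>v. d / norm x * (x \<bullet> v))) (at x)"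
proof -
  have "((\<lambda>y. \<phi> (norm y)) has_derivative (\<lambda>v. d * (sgn x \<bullet> v))) (at x)"
    using has_derivative_compose[OF has_derivative_norm[OF assms(1)], of \<phi>] assms(2)
    by (simp add: has_field_derivative_def inner_commute)
  then show ?thesis by (simp add: sgn_div_norm divide_inverse mult.assoc)
qed

lemma has_derivative_radial_component:
  fixes x :: "real^'n"
  assumes "x \<noteq> 0" and "(\<psi> has_real_derivative d) (at (norm x))"
  shows "((\<lambda>y. \<psi> (norm y) * y $ i) has_derivative
    (\<lambda>v. \<psi> (norm x) * v $ i + d / norm x * (x \<bullet> v) * x $ i)) (at x)"
proof -
  have "((\<lambda>y. y $ i) has_derivative (\<lambda>v. v $ i)) (at x)"
    by (rule bounded_linear.has_derivative[OF bounded_linear_vec_nth has_derivative_ident])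
  from has_derivative_mult[OF has_derivative_radial[OF assms] this] show ?thesis .
qed

text \<open>With \<phi>' = r \<psi> the gradient is \<psi>(|x|) x, and \<open>\<xi>\<close> stands
  for r \<psi>'. Differentiating once more gives \<psi> I plus \<xi> times the projection onto x, so
  the radial eigenvalue is \<psi> + \<xi>.\<close>

lemma radial_second_derivative:
  fixes x :: "real^'n"
  assumes "x \<noteq> 0" and \<phi>: "\<And>r. r > 0 \<Longrightarrow> (\<phi> has_real_derivative r * \<psi> r) (at r)"
    and \<psi>: "(\<psi> has_real_derivative \<xi> / norm x) (at (norm x))"
  shows "(partial_deriv i (\<lambda>y. \<phi> (norm y)) has_derivative
    (\<lambda>v. \<psi> (norm x) * v $ i + \<xi> / (norm x)\<^sup>2 * (x \<bullet> v) * x $ i)) (at x)"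
proof -
  have "partial_deriv i (\<lambda>y. \<phi> (norm y)) y = \<psi> (norm y) * y $ i" if "y \<in> - {0}" for y :: "real^'n"
    using that partial_deriv_eqI[OF has_derivative_radial[OF _ \<phi>], of y i]
    by (simp add: inner_axis)
  moreover have "((\<lambda>y. \<psi> (norm y) * y $ i) has_derivative
      (\<lambda>v. \<psi> (norm x) * v $ i + \<xi> / (norm x)\<^sup>2 * (x \<bullet> v) * x $ i)) (at x)"
    using has_derivative_radial_component[OF assms(1) \<psi>, of i] by (simp add: power2_eq_square)
  ultimately show ?thesis
    using assms(1) has_derivative_transform_within_open[of _ _ x UNIV "- {0}"] by fastforce
qed

lemma hessian_radial:
  fixes x :: "real^'n"
  assumes "x \<noteq> 0" and "\<And>r. r > 0 \<Longrightarrow> (\<phi> has_real_derivative r * \<psi> r) (at r)"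
    and "(\<psi> has_real_derivative \<xi> / norm x) (at (norm x))"
  shows "hessian (\<lambda>y. \<phi> (norm y)) x =
    (\<chi> i j. (if i = j then \<psi> (norm x) else 0) + \<xi> / (norm x)\<^sup>2 * x $ i * x $ j)"
proof -
  have "partial_deriv i (partial_deriv j (\<lambda>y. \<phi> (norm y))) x =
      (if i = j then \<psi> (norm x) else 0) + \<xi> / (norm x)\<^sup>2 * x $ i * x $ j" for i j
    using partial_deriv_eqI[OF radial_second_derivative[OF assms], of i j]
    by (simp add: inner_axis; auto simp: axis_def)
  then show ?thesis by (simp add: hessian_def vec_eq_iff)
qed

section \<open>Second-order regularity of radial functions at the origin\<close>

lemma filterlim_norm_at_right_0: "filterlim norm (at_right 0) (at (0::'a::real_normed_vector))"
  by (auto simp: filterlim_at eventually_at_filter intro!: tendsto_eq_intros)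

lemma continuous_at_0_radial:
  fixes f :: "real \<Rightarrow> real"
  assumes "continuous_on {0..} f"
  shows "((\<lambda>y::'a::real_normed_vector. f (norm y)) \<longlongrightarrow> f 0) (at 0)"
proof -
  have "(f \<longlongrightarrow> f 0) (at 0 within {0..})"
    using assms by (auto simp: continuous_on)
  then have "(f \<longlongrightarrow> f 0) (at_right 0)"
    by (rule tendsto_within_subset) auto
  then show ?thesis
    by (rule filterlim_compose[OF _ filterlim_norm_at_right_0])
qed

lemma continuous_on_radial:
  fixes f :: "real \<Rightarrow> real"
  assumes "continuous_on {0..} f"
  shows "continuous_on UNIV (\<lambda>y::'a::real_normed_vector. f (norm y))"
  by (rule continuous_on_compose2[OF assms]) (auto intro: continuous_intros)

text \<open>Here \<psi> = \<phi>'/r and \<xi> = r \<psi>' = \<phi>'' - \<phi>'/r. Differentiability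
  of \<psi> at 0 is replaced by continuity of \<xi> with \<xi>(0) = 0, which is what continuity of
  the Hessian at the origin rests on.\<close>

locale radial_profile =
  fixes \<phi> \<psi> \<xi> :: "real \<Rightarrow> real"
  assumes \<phi>_deriv: "\<And>r. r > 0 \<Longrightarrow> (\<phi> has_real_derivative r * \<psi> r) (at r)"
    and \<phi>_deriv_0: "(\<phi> has_real_derivative 0) (at 0 within {0..})"
    and \<psi>_deriv: "\<And>r. r > 0 \<Longrightarrow> (\<psi> has_real_derivative \<xi> r / r) (at r)"
    and cont_\<psi>: "continuous_on {0..} \<psi>"
    and cont_\<xi>: "continuous_on {0..} \<xi>"
    and \<xi>_0: "\<xi> 0 = 0"
begin

lemma has_derivative_profile:
  fixes x :: "real^'n"
  shows "((\<lambda>y. \<phi> (norm y)) has_derivative (\<lambda>v. \<psi> (norm x) * (x \<bullet> v))) (at x)"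
proof (cases "x = 0")
  case False
  then show ?thesis using has_derivative_radial[OF False \<phi>_deriv] by simp
next
  case True
  \<comment> \<open>Since \<open>norm y\<close> tends to 0 from the right, a vanishing one-sided
    derivative of \<phi> makes the increment o(|y|).\<close>
  have "((\<lambda>r. (\<phi> r - \<phi> 0) / (r - 0)) \<longlongrightarrow> 0) (at 0 within {0..})"
    using \<phi>_deriv_0 by (simp add: has_field_derivative_iff)
  then have "((\<lambda>r. (\<phi> r - \<phi> 0) / r) \<longlongrightarrow> 0) (at_right 0)"
    by (intro tendsto_within_subset[where S = "{0..}" and T = "{0<..}"]) auto
  then have "((\<lambda>y::real^'n. (\<phi> (norm y) - \<phi> 0) / norm y) \<longlongrightarrow> 0) (at 0)"
    by (rule filterlim_compose[OF _ filterlim_norm_at_right_0])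
  then have "((\<lambda>y::real^'n. \<bar>(\<phi> (norm y) - \<phi> 0) / norm y\<bar>) \<longlongrightarrow> 0) (at 0)"
    by (rule tendsto_rabs_zero)
  then show ?thesis
    unfolding True has_derivative_iff_norm by (simp add: abs_divide)
qed

lemma partial_deriv_profile:
  fixes x :: "real^'n"
  shows "partial_deriv i (\<lambda>y. \<phi> (norm y)) x = \<psi> (norm x) * x $ i"
  by (subst partial_deriv_eqI[OF has_derivative_profile]) (simp add: inner_axis)

lemma has_second_derivative_profile:
  fixes x :: "real^'n"
  shows "((\<lambda>y. \<psi> (norm y) * y $ i) has_derivative
    (\<lambda>v. \<psi> (norm x) * v $ i + \<xi> (norm x) / (norm x)\<^sup>2 * (x \<bullet> v) * x $ i)) (at x)"
proof (cases "x = 0")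
  case False
  then show ?thesis
    using has_derivative_radial_component[OF False \<psi>_deriv] by (simp add: power2_eq_square)
next
  case True
  \<comment> \<open>At x = 0 the candidate derivative is v -> \<psi>(0) v_i, and the error
    |\<psi>(|y|) - \<psi>(0)| |y_i| is o(|y|) by continuity of \<psi>.\<close>
  have "((\<lambda>y::real^'n. \<psi> (norm y) - \<psi> 0) \<longlongrightarrow> 0) (at 0)"
    using continuous_at_0_radial[OF cont_\<psi>] by (simp add: LIM_zero_iff)
  then have "((\<lambda>y::real^'n. \<bar>\<psi> (norm y) - \<psi> 0\<bar>) \<longlongrightarrow> 0) (at 0)"
    by (rule tendsto_rabs_zero)
  then have "((\<lambda>y::real^'n. norm (\<psi> (norm y) * y $ i - \<psi> 0 * y $ i) / norm y) \<longlongrightarrow> 0) (at 0)"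
  proof (rule Lim_null_comparison[rotated])
    have "norm (norm (\<psi> (norm y) * y $ i - \<psi> 0 * y $ i) / norm y) \<le> \<bar>\<psi> (norm y) - \<psi> 0\<bar>" for y :: "real^'n"
    proof -
      have "\<bar>\<psi> (norm y) - \<psi> 0\<bar> * \<bar>y $ i\<bar> \<le> \<bar>\<psi> (norm y) - \<psi> 0\<bar> * norm y"
        by (intro mult_left_mono component_le_norm_cart) auto
      then show ?thesis
        by (cases "y = 0") (auto simp: divide_le_eq abs_mult simp flip: left_diff_distrib)
    qed
    then show "\<forall>\<^sub>F y :: real^'n in at 0. norm (norm (\<psi> (norm y) * y $ i - \<psi> 0 * y $ i) / norm y) \<le> \<bar>\<psi> (norm y) - \<psi> 0\<bar>"
      by simp
  qed
  moreover have "bounded_linear (\<lambda>v::real^'n. \<psi> 0 * v $ i)"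
    by (intro bounded_linear_const_mult bounded_linear_vec_nth)
  ultimately show ?thesis
    unfolding True has_derivative_iff_norm by simp
qed

lemma partial_deriv2_profile:
  fixes x :: "real^'n"
  shows "partial_deriv j (partial_deriv i (\<lambda>y. \<phi> (norm y))) x =
    (if j = i then \<psi> (norm x) else 0) + \<xi> (norm x) / (norm x)\<^sup>2 * x $ j * x $ i"
proof -
  have "partial_deriv i (\<lambda>y::real^'n. \<phi> (norm y)) = (\<lambda>y. \<psi> (norm y) * y $ i)"
    using partial_deriv_profile by blast
  then show ?thesis
    using partial_deriv_eqI[OF has_second_derivative_profile, of j i x]
    by (simp add: inner_axis; auto simp: axis_def)
qed

lemma hessian_profile:
  fixes x :: "real^'n"
  shows "hessian (\<lambda>y. \<phi> (norm y)) x =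
    (\<chi> i j. (if i = j then \<psi> (norm x) else 0) + \<xi> (norm x) / (norm x)\<^sup>2 * x $ i * x $ j)"
  by (simp add: hessian_def partial_deriv2_profile)

text \<open>Only the origin is delicate: |x_j x_i| is at most |x|^2, so the quotient term is
  dominated by |\<xi>(|x|)|, which tends to \<xi>(0) = 0.\<close>

lemma continuous_on_second_derivative:
  "continuous_on UNIV (\<lambda>x::real^'n. (if j = i then \<psi> (norm x) else 0) + \<xi> (norm x) / (norm x)\<^sup>2 * x $ j * x $ i)"
proof -
  have "isCont (\<lambda>x::real^'n. \<xi> (norm x) / (norm x)\<^sup>2 * x $ j * x $ i) x" for x
  proof (cases "x = 0")
    case False
    have "isCont (\<lambda>x::real^'n. \<xi> (norm x)) x"
      using continuous_on_radial[OF cont_\<xi>, where 'a = "real^'n"] by (simp add: continuous_on_eq_continuous_at)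
    then show ?thesis using False by (intro continuous_intros) auto
  next
    case True
    have "((\<lambda>y::real^'n. \<xi> (norm y)) \<longlongrightarrow> 0) (at 0)"
      using continuous_at_0_radial[OF cont_\<xi>] by (simp add: \<xi>_0)
    then have "((\<lambda>y::real^'n. \<bar>\<xi> (norm y)\<bar>) \<longlongrightarrow> 0) (at 0)"
      by (rule tendsto_rabs_zero)
    then have "((\<lambda>y::real^'n. \<xi> (norm y) / (norm y)\<^sup>2 * y $ j * y $ i) \<longlongrightarrow> 0) (at 0)"
    proof (rule Lim_null_comparison[rotated])
      have "norm (\<xi> (norm y) / (norm y)\<^sup>2 * y $ j * y $ i) \<le> \<bar>\<xi> (norm y)\<bar>" for y :: "real^'n"
      proof -
        have "\<bar>y $ j\<bar> * \<bar>y $ i\<bar> \<le> norm y * norm y"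
          by (intro mult_mono component_le_norm_cart) auto
        then have "\<bar>\<xi> (norm y)\<bar> / (norm y)\<^sup>2 * (\<bar>y $ j\<bar> * \<bar>y $ i\<bar>) \<le> \<bar>\<xi> (norm y)\<bar> / (norm y)\<^sup>2 * (norm y * norm y)"
          by (intro mult_left_mono) auto
        then show ?thesis by (cases "y = 0") (auto simp: abs_mult power2_eq_square mult.assoc)
      qed
      then show "\<forall>\<^sub>F y :: real^'n in at 0. norm (\<xi> (norm y) / (norm y)\<^sup>2 * y $ j * y $ i) \<le> \<bar>\<xi> (norm y)\<bar>"
        by simp
    qed
    then show ?thesis by (simp add: True isCont_def)
  qed
  then have "continuous_on UNIV (\<lambda>x::real^'n. \<xi> (norm x) / (norm x)\<^sup>2 * x $ j * x $ i)"
    by (simp add: continuous_at_imp_continuous_on)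
  moreover have "continuous_on UNIV (\<lambda>x::real^'n. if j = i then \<psi> (norm x) else 0)"
    by (cases "j = i") (simp_all add: continuous_on_radial[OF cont_\<psi>])
  ultimately show ?thesis by (rule continuous_on_add[rotated])
qed

lemma C2_fun_profile: "C2_fun (\<lambda>x::real^'n. \<phi> (norm x))"
proof -
  have 1: "partial_deriv i (\<lambda>y::real^'n. \<phi> (norm y)) = (\<lambda>y. \<psi> (norm y) * y $ i)" for i
    using partial_deriv_profile by blast
  have 2: "partial_deriv j (\<lambda>y::real^'n. \<psi> (norm y) * y $ i) = 
      (\<lambda>x. (if j = i then \<psi> (norm x) else 0) + \<xi> (norm x) / (norm x)\<^sup>2 * x $ j * x $ i)" for i j
    using partial_deriv2_profile[of j i] unfolding 1 by blast
  have 3: "continuous_on UNIV (\<lambda>y::real^'n. \<psi> (norm y) * y $ i)" for i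
    by (intro continuous_on_mult continuous_on_radial cont_\<psi> continuous_intros)
  have 4: "C1_fun (\<lambda>y::real^'n. \<phi> (norm y))"
    unfolding C1_fun_def 1 using 3 differentiableI[OF has_derivative_profile] by blast
  have 5: "C1_fun (\<lambda>y::real^'n. \<psi> (norm y) * y $ i)" for i
    unfolding C1_fun_def 2
    using continuous_on_second_derivative differentiableI[OF has_second_derivative_profile] by blast
  show ?thesis
    unfolding C2_fun_def 1 using 4 5 by blast
qed

end

section \<open>Profiles of given radial C^2 functions\<close>

lemma radial_C2_profile:
  fixes u :: "real^'n \<Rightarrow> real"
  assumes "C2_fun u" "radial u"
  obtains \<phi> \<phi>' \<phi>'' where "\<And>x. u x = \<phi> (norm x)"
    "\<And>t. (\<phi> has_real_derivative \<phi>' t) (at t)" "\<And>t. (\<phi>' has_real_derivative \<phi>'' t) (at t)"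
    "\<phi>' 0 = 0"
proof -
  obtain f where f: "\<And>x. u x = f (norm x)" using assms(2) by (auto simp: radial_def)
  fix m :: 'n
  let ?e = "axis m 1 :: real^'n"
  have deriv: "((\<lambda>t. w (t *\<^sub>R ?e)) has_real_derivative partial_deriv m w (t *\<^sub>R ?e)) (at t)"
    if "C1_fun w" for w :: "real^'n \<Rightarrow> real" and t
  proof -
    have D: "(w has_derivative frechet_derivative w (at (t *\<^sub>R ?e))) (at (t *\<^sub>R ?e))"
      using that by (simp add: C1_fun_def frechet_derivative_works)
    then interpret bounded_linear "frechet_derivative w (at (t *\<^sub>R ?e))"
      by (rule has_derivative_bounded_linear)
    have "((\<lambda>t. t *\<^sub>R ?e) has_derivative (\<lambda>s. s *\<^sub>R ?e)) (at t)"
      by (auto intro!: derivative_eq_intros)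
    from has_derivative_compose[OF this D]
    have "((\<lambda>t. w (t *\<^sub>R ?e)) has_derivative (\<lambda>s. frechet_derivative w (at (t *\<^sub>R ?e)) (s *\<^sub>R ?e))) (at t)" .
    then show ?thesis
      by (simp add: has_field_derivative_def partial_deriv_def scaleR mult.commute[of _ "frechet_derivative _ _ _"] cong: if_cong)
  qed
  \<comment> \<open>The profile is the restriction of u to a coordinate line through the origin,
    hence differentiable twice on the whole real line.\<close>
  let ?\<phi> = "\<lambda>t. u (t *\<^sub>R ?e)" and ?\<phi>' = "\<lambda>t. partial_deriv m u (t *\<^sub>R ?e)"
    and ?\<phi>'' = "\<lambda>t. partial_deriv m (partial_deriv m u) (t *\<^sub>R ?e)"
  have 1: "(?\<phi> has_real_derivative ?\<phi>' t) (at t)" for t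
    using assms(1) by (intro deriv) (simp add: C2_fun_def)
  have 2: "(?\<phi>' has_real_derivative ?\<phi>'' t) (at t)" for t
    using assms(1) by (intro deriv) (simp add: C2_fun_def)
  have "?\<phi>' 0 = 0"
  proof -
    \<comment> \<open>Radial symmetry makes the profile even, and the derivative of an even function
      vanishes at 0.\<close>
    have "((\<lambda>t. ?\<phi> (- t)) has_real_derivative - ?\<phi>' 0) (at 0)"
      using DERIV_mirror[of ?\<phi> "?\<phi>' 0" 0] 1[of 0] by simp
    moreover have "(\<lambda>t. ?\<phi> (- t)) = ?\<phi>" by (simp add: f)
    ultimately have "?\<phi>' 0 = - ?\<phi>' 0" using 1[of 0] DERIV_unique by metis
    then show ?thesis by simp
  qed
  moreover have "u x = ?\<phi> (norm x)" for x by (simp add: f)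
  ultimately show thesis using that[of ?\<phi> ?\<phi>' ?\<phi>''] 1 2 by blast
qed

text \<open>Off the origin the eigenvalues are \<phi>'' once and \<phi>'/r with multiplicity N - 1;
  \<open>?\<xi>\<close> is chosen so that \<psi> + \<xi> = \<phi>''.\<close>

lemma elem_sym_hessian_radial:
  fixes u :: "real^'n \<Rightarrow> real"
  assumes "\<And>x. u x = \<phi> (norm x)" "\<And>t. (\<phi> has_real_derivative \<phi>' t) (at t)"
    "\<And>t. (\<phi>' has_real_derivative \<phi>'' t) (at t)" "x \<noteq> 0" "j \<ge> 1"
  shows "elem_sym j (eigenvalues (hessian u x)) =
    real ((CARD('n) - 1) choose (j - 1)) * \<phi>'' (norm x) * (\<phi>' (norm x) / norm x) ^ (j - 1)
    + real ((CARD('n) - 1) choose j) * (\<phi>' (norm x) / norm x) ^ j"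
proof -
  let ?\<psi> = "\<lambda>r. \<phi>' r / r"
  let ?\<xi> = "\<phi>'' (norm x) - \<phi>' (norm x) / norm x"
  have u: "u = (\<lambda>y. \<phi> (norm y))" using assms(1) by blast
  have "hessian u x = (\<chi> i j. (if i = j then ?\<psi> (norm x) else 0) + ?\<xi> / (norm x)\<^sup>2 * x $ i * x $ j)"
    unfolding u
  proof (rule hessian_radial[OF assms(4)])
    show "(\<phi> has_real_derivative r * (\<phi>' r / r)) (at r)" if "r > 0" for r
      using assms(2)[of r] that by simp
    show "(?\<psi> has_real_derivative ?\<xi> / norm x) (at (norm x))"
      using assms(4) by (auto intro!: derivative_eq_intros assms(3) simp: field_simps)
  qed
  then show ?thesis
    using elem_sym_eigenvalues_rank_one_update[OF assms(5), of "?\<psi> (norm x)" "?\<xi> / (norm x)\<^sup>2" x] assms(4)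
    by simp
qed

subsection \<open>The Keller--Osserman function\<close>

lemma nn_integral_atLeast_le_of_bounded_primitive:
  fixes f F d :: "real \<Rightarrow> real"
  assumes f: "continuous_on {a<..} f" "\<And>x. x > a \<Longrightarrow> 0 \<le> f x"
    and F: "continuous_on {a..} F" "\<And>x. x > a \<Longrightarrow> (F has_real_derivative d x) (at x)"
    and le: "\<And>x. x > a \<Longrightarrow> f x \<le> d x" and B: "\<And>x. x \<ge> a \<Longrightarrow> F x \<le> B"
  shows "(\<integral>\<^sup>+ t\<in>{a..}. ennreal (f t) \<partial>lborel) \<le> ennreal (B - F a)"
proof -
  \<comment> \<open>The intervals exhaust the open half-line, since the integrand may be singular at
    a, as with the factor 1/t^(N-k) in (b). Each piece is bounded through the primitive, and
    monotone convergence gives the whole.\<close>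
  define l r where "l n = a + inverse (real (Suc n))" and "r n = a + real (Suc n)" for n
  let ?f = "\<lambda>n x. ennreal (indicator {l n..r n} x * f x)"
  have lr: "a < l n" "l n \<le> r n" for n
  proof -
    have "inverse (real (Suc n)) \<le> 1" by (rule inverse_le_1_iff[THEN iffD2]) simp
    then show "l n \<le> r n" by (simp add: l_def r_def)
  qed (simp add: l_def)
  have bd: "integral\<^sup>N lborel (?f n) \<le> ennreal (B - F a)" for n
  proof -
    have sub: "{l n..r n} \<subseteq> {a<..}" using lr[of n] by auto
    have int: "f integrable_on {l n..r n}"
      by (intro integrable_continuous_real continuous_on_subset[OF f(1) sub])
    have d: "(d has_integral (F (r n) - F (l n))) {l n..r n}"
    proof (rule fundamental_theorem_of_calculus[OF lr(2)])
      show "(F has_vector_derivative d x) (at x within {l n..r n})" if "x \<in> {l n..r n}" for x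
        unfolding has_real_derivative_iff_has_vector_derivative[symmetric]
        by (rule has_field_derivative_at_within[OF F(2)]) (use that lr(1)[of n] in auto)
    qed
    have "(f has_integral integral {l n..r n} f) {l n..r n}"
      using int by (rule integrable_integral)
    then have 1: "integral {l n..r n} f \<le> F (r n) - F (l n)"
      by (rule has_integral_le[OF _ d]) (use le lr[of n] in auto)
    \<comment> \<open>\<open>F\<close> is nondecreasing because its derivative dominates the
      nonnegative \<open>f\<close>.\<close>
    have "F a \<le> F (l n)"
    proof (rule DERIV_nonneg_imp_increasing_open[where f = F])
      show "\<exists>y. (F has_real_derivative y) (at x) \<and> y \<ge> 0" if "a < x" for x
        using F(2)[OF that] le[OF that] f(2)[OF that] by (meson order_trans)
      show "continuous_on {a..l n} F" by (rule continuous_on_subset[OF F(1)]) auto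
    qed (use lr[of n] in auto)
    moreover have "F (r n) \<le> B"
      using lr[of n] by (intro B) linarith
    ultimately have "ennreal (integral {l n..r n} f) \<le> ennreal (B - F a)"
      using 1 by (intro ennreal_leI) linarith
    moreover have "integral\<^sup>N lborel (?f n) = ennreal (integral {l n..r n} f)"
      using int lr[of n] by (intro nn_integral_has_integral_lebesgue integrable_integral f(2)) auto
    ultimately show ?thesis by simp
  qed
  have "(\<lambda>n. integral\<^sup>N lborel (?f n)) \<longlonglongrightarrow> (\<integral>\<^sup>+ t. ennreal (indicator {a<..} t * f t) \<partial>lborel)"
  proof (rule nn_integral_LIMSEQ)
    have "?f m x \<le> ?f n x" if "m \<le> n" for m n x
    proof (rule ennreal_leI)
      have "{l m..r m} \<subseteq> {l n..r n}" using that by (auto simp: l_def r_def field_simps)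
      moreover have "0 \<le> f x" if "x \<in> {l m..r m} \<union> {l n..r n}"
        using that lr[of m] lr[of n] by (intro f(2)) auto
      ultimately show "indicator {l m..r m} x * f x \<le> indicator {l n..r n} x * f x"
        by (auto simp: indicator_def)
    qed
    then show "incseq ?f" by (auto simp: incseq_def le_fun_def)
    show "?f n \<in> borel_measurable lborel" for n
    proof -
      have "{l n..r n} \<subseteq> {a<..}" using lr[of n] by auto
      then have "(\<lambda>x. indicator {l n..r n} x *\<^sub>R f x) \<in> borel_measurable borel"
        by (intro borel_measurable_continuous_on_indicator continuous_on_subset[OF f(1)]) auto
      then show ?thesis by simp
    qed
    show "(\<lambda>n. ?f n x) \<longlonglongrightarrow> ennreal (indicator {a<..} x * f x)" for x
    proof (cases "x > a")
      case True
      obtain n1 where n1: "inverse (real (Suc n1)) < x - a"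
        using True reals_Archimedean[of "x - a"] by auto
      obtain n2 where n2: "x - a \<le> real n2" using real_arch_simple by blast
      have "?f n x = ennreal (indicator {a<..} x * f x)" if "n \<ge> max n1 n2" for n
      proof -
        have "inverse (real (Suc n)) \<le> inverse (real (Suc n1))" using that by (intro le_imp_inverse_le) auto
        moreover have "real n2 \<le> real n" using that by simp
        ultimately have "l n \<le> x" "x \<le> r n" using n1 n2 unfolding l_def r_def by linarith+
        then have "x \<in> {l n..r n}" by simp
        then show ?thesis using True by simp
      qed
      then have "\<forall>\<^sub>F n in sequentially. ?f n x = ennreal (indicator {a<..} x * f x)"
        unfolding eventually_sequentially by blast
      then show ?thesis by (rule tendsto_eventually)
    next
      case False
      then have "x \<notin> {l n..r n}" for n using lr[of n] by auto
      then show ?thesis using False by simp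
    qed
  qed
  then have "(\<integral>\<^sup>+ t. ennreal (indicator {a<..} t * f t) \<partial>lborel) \<le> ennreal (B - F a)"
    by (rule LIMSEQ_le_const2) (use bd in auto)
  moreover have "(\<integral>\<^sup>+ t\<in>{a..}. ennreal (f t) \<partial>lborel) = (\<integral>\<^sup>+ t. ennreal (indicator {a<..} t * f t) \<partial>lborel)"
  proof (rule nn_integral_cong_AE)
    have "AE t in lborel. t \<noteq> a" by (rule AE_lborel_singleton)
    then show "AE t in lborel. ennreal (f t) * indicator {a..} t = ennreal (indicator {a<..} t * f t)"
      by eventually_elim (auto simp: indicator_def)
  qed
  ultimately show ?thesis by simp
qed

lemma ennreal_integral_le_nn_integral:
  fixes f :: "real \<Rightarrow> real"
  assumes "continuous_on {a..b} f" "\<And>x. x \<in> {a..b} \<Longrightarrow> 0 \<le> f x" "{a..b} \<subseteq> S"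
  shows "ennreal (integral {a..b} f) \<le> (\<integral>\<^sup>+ t\<in>S. ennreal (f t) \<partial>lborel)"
proof -
  have "ennreal (integral {a..b} f) = (\<integral>\<^sup>+ t. ennreal (indicator {a..b} t * f t) \<partial>lborel)"
    using assms(2) integrable_integral[OF integrable_continuous_real[OF assms(1)]]
    by (rule nn_integral_has_integral_lebesgue[symmetric])
  also have "\<dots> \<le> (\<integral>\<^sup>+ t\<in>S. ennreal (f t) \<partial>lborel)"
    using assms(3) by (intro nn_integral_mono) (auto simp: indicator_def)
  finally show ?thesis .
qed

lemma integral_has_real_derivative_at:
  fixes f :: "real \<Rightarrow> real"
  assumes "continuous_on {a..} f" "x > a"
  shows "((\<lambda>y. integral {a..y} f) has_real_derivative f x) (at x)"
proof -
  have "((\<lambda>y. integral {a..y} f) has_real_derivative f x) (at x within {a..x + 1})"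
    using assms by (intro integral_has_real_derivative continuous_on_subset[OF assms(1)]) auto
  moreover have "at x within {a..x + 1} = at x"
    using assms(2) by (intro at_within_interior) auto
  ultimately show ?thesis by simp
qed

lemma continuous_on_integral_atLeast:
  fixes f :: "real \<Rightarrow> real"
  assumes "continuous_on {a..} f"
  shows "continuous_on {a..} (\<lambda>y. integral {a..y} f)"
proof -
  have "((\<lambda>y. integral {a..y} f) has_real_derivative f x) (at x within {a..x + 1})" if "x \<ge> a" for x
    using that by (intro integral_has_real_derivative continuous_on_subset[OF assms]) auto
  moreover have "at x within {a..x + 1} = at x within {a..}" if "x \<ge> a" for x
    by (rule at_within_nhd[of _ "{x - 1<..<x + 1}"]) auto
  ultimately show ?thesis
    by (intro DERIV_continuous_on[where D = f]) auto
qed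

section \<open>The unbounded primitive G and the comparison principle\<close>

locale keller_osserman =
  fixes k :: nat and h H :: "real \<Rightarrow> real"
  assumes k_pos: "k \<ge> 1"
    and cont_h: "continuous_on {0..} h" and h_nonneg: "\<And>s. s \<ge> 0 \<Longrightarrow> h s \<ge> 0"
    and mono_h: "mono_on {0..} h" and h_pos: "\<And>s. s > 0 \<Longrightarrow> h s > 0"
    and H_eq: "\<And>t. t \<ge> 0 \<Longrightarrow> H t = integral {0..t} (\<lambda>z. h z ^ k)"
    and divergence: "(\<integral>\<^sup>+ t\<in>{1..}. ennreal (1 / root (k + 1) ((real k + 1) * H t)) \<partial>lborel) = \<infinity>"
begin

definition w :: "real \<Rightarrow> real" where "w t = root (k + 1) ((real k + 1) * H t)"

text \<open>The base point 1/2 avoids 0, where \<open>w\<close> vanishes, and lies below 1, so that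
  \<open>G\<close> has a two-sided derivative at every v \<ge> 1.\<close>

definition G :: "real \<Rightarrow> real" where "G v = integral {1/2..v} (\<lambda>t. 1 / w t)"

lemma cont_hk: "continuous_on {0..} (\<lambda>z. h z ^ k)"
  by (intro continuous_intros cont_h)

lemma H_deriv: "(H has_real_derivative h t ^ k) (at t)" if "t > 0"
  using integral_has_real_derivative_at[OF cont_hk that]
  by (rule has_field_derivative_transform_within_open[where S = "{0<..}"])
    (use that H_eq in auto)

lemma cont_H: "continuous_on {0..} H"
  using continuous_on_integral_atLeast[OF cont_hk]
  by (rule continuous_on_cong[THEN iffD1, rotated 2]) (auto simp: H_eq)

lemma H_mono: "0 \<le> s \<Longrightarrow> s \<le> t \<Longrightarrow> H s \<le> H t"
proof (rule DERIV_nonneg_imp_increasing_open[where f = H])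
  show "continuous_on {s..t} H" if "0 \<le> s" by (rule continuous_on_subset[OF cont_H]) (use that in auto)
  show "\<exists>y. (H has_real_derivative y) (at x) \<and> y \<ge> 0" if "0 \<le> s" "s < x" for x
    using that H_deriv[of x] h_nonneg[of x] by (intro exI[of _ "h x ^ k"]) auto
qed auto

lemma H_pos: "H t > 0" if "t > 0"
proof -
  have "H 0 < H t"
  proof (rule DERIV_pos_imp_increasing_open[where f = H])
    show "continuous_on {0..t} H" by (rule continuous_on_subset[OF cont_H]) auto
    show "\<exists>y. (H has_real_derivative y) (at x) \<and> y > 0" if "0 < x" for x
      using that H_deriv[of x] h_pos[of x] by (intro exI[of _ "h x ^ k"]) auto
  qed (use that in auto)
  then show ?thesis by (simp add: H_eq)
qed

lemma w_pos: "t > 0 \<Longrightarrow> w t > 0"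
  using H_pos[of t] by (simp add: w_def)

lemma cont_inverse_w: "continuous_on {1/2..} (\<lambda>t. 1 / w t)"
proof (rule continuous_on_divide)
  show "continuous_on {1/2..} w"
    unfolding w_def by (intro continuous_intros continuous_on_subset[OF cont_H]) auto
  show "\<forall>t\<in>{1/2..}. w t \<noteq> 0"
  proof
    show "w t \<noteq> 0" if "t \<in> {1/2..}" for t
      using w_pos[of t] that by auto
  qed
qed auto

lemma G_deriv: "v > 1/2 \<Longrightarrow> (G has_real_derivative 1 / w v) (at v)"
  unfolding G_def[abs_def] by (rule integral_has_real_derivative_at[OF cont_inverse_w])

lemma G_mono: "G s \<le> G t" if "1 \<le> s" "s \<le> t"
proof (rule DERIV_nonneg_imp_nondecreasing[where f = G])
  show "\<exists>y. (G has_real_derivative y) (at x) \<and> y \<ge> 0" if "s \<le> x" for x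
    using that \<open>1 \<le> s\<close> G_deriv[of x] w_pos[of x] by (intro exI[of _ "1 / w x"]) auto
qed fact

text \<open>A bound on \<open>G\<close> would bound the integral of its derivative 1 /
  \<open>w\<close> over {1..}, against \<open>divergence\<close>.\<close>

lemma G_unbounded: "\<exists>v\<ge>1. G v > B"
proof (rule ccontr)
  assume "\<not> (\<exists>v\<ge>1. G v > B)"
  then have B: "G v \<le> B" if "v \<ge> 1" for v using that by force
  have "(\<integral>\<^sup>+ t\<in>{1..}. ennreal (1 / w t) \<partial>lborel) \<le> ennreal (B - G 1)"
  proof (rule nn_integral_atLeast_le_of_bounded_primitive)
    show "continuous_on {1<..} (\<lambda>t. 1 / w t)"
      by (rule continuous_on_subset[OF cont_inverse_w]) auto
    show "continuous_on {1..} G"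
      by (intro DERIV_continuous_on[where D = "\<lambda>v. 1 / w v"] has_field_derivative_at_within[OF G_deriv]) auto
    show "(G has_real_derivative 1 / w x) (at x)" "0 \<le> 1 / w x" if "x > 1" for x
      using G_deriv[of x] w_pos[of x] that by auto
  qed (use B in auto)
  also have "\<dots> < \<infinity>" by simp
  finally show False using divergence by (simp add: w_def)
qed

text \<open>The function \<^term>\<open>G\<close> turns the differential inequality \<open>y' \<le> q w(y)\<close> into
  \<open>(G \<circ> y)' \<le> q\<close>.\<close>

lemma G_compare:
  assumes "a \<le> b" and y: "continuous_on {a..b} y" "\<And>t. t \<in> {a..b} \<Longrightarrow> y t \<ge> 1"
    "\<And>t. a < t \<Longrightarrow> t < b \<Longrightarrow> (y has_real_derivative y' t) (at t)"
    and Q: "continuous_on {a..b} Q" "\<And>t. a < t \<Longrightarrow> t < b \<Longrightarrow> (Q has_real_derivative q t) (at t)"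
    and le: "\<And>t. a < t \<Longrightarrow> t < b \<Longrightarrow> y' t \<le> q t * w (y t)"
  shows "G (y b) - G (y a) \<le> Q b - Q a"
proof -
  have "Q a - G (y a) \<le> Q b - G (y b)"
  proof (rule DERIV_nonneg_imp_increasing_open[OF assms(1), where f = "\<lambda>t. Q t - G (y t)"])
    have "continuous_on {1..} G"
      by (intro DERIV_continuous_on[where D = "\<lambda>v. 1 / w v"] has_field_derivative_at_within[OF G_deriv]) auto
    then have "continuous_on {a..b} (\<lambda>t. G (y t))"
      by (rule continuous_on_compose2) (use y in auto)
    then show "continuous_on {a..b} (\<lambda>t. Q t - G (y t))"
      by (intro continuous_intros Q)
    show "\<exists>d. ((\<lambda>t. Q t - G (y t)) has_real_derivative d) (at t) \<and> 0 \<le> d" if t: "a < t" "t < b" for t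
    proof (intro exI conjI)
      have y1: "y t \<ge> 1" using y(2) t by simp
      then show "((\<lambda>t. Q t - G (y t)) has_real_derivative q t - 1 / w (y t) * y' t) (at t)"
        using t by (intro derivative_intros DERIV_chain2[OF G_deriv] Q y) auto
      show "0 \<le> q t - 1 / w (y t) * y' t"
        using le[OF t] w_pos[of "y t"] y1 by (simp add: field_simps)
    qed
  qed
  then show ?thesis by simp
qed

end

subsection \<open>The radial equation and its Picard iteration\<close>

text \<open>At j = k this absorption identity turns the radial operator into the derivative of
  r^(N-k) \<phi>'^k; for smaller j it makes S_j comparable with S_k.\<close>

lemma choose_pred_step:
  fixes N j :: nat
  assumes "1 \<le> j" "j \<le> N"
  shows "real j * real ((N - 1) choose j) = (real N - real j) * real ((N - 1) choose (j - 1))"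
proof -
  obtain i where i: "j = Suc i" using assms(1) by (cases j) auto
  have "Suc i * ((N - 1) choose Suc i) = (N - 1 - i) * ((N - 1) choose i)"
    by (simp only: binomial_absorption binomial_absorb_comp)
  then have "real (Suc i) * real ((N - 1) choose Suc i) = real (N - 1 - i) * real ((N - 1) choose i)"
    by (metis of_nat_mult)
  moreover have "real (N - 1 - i) = real N - real j" using assms i by simp
  ultimately show ?thesis by (simp add: i)
qed

locale hessian_ode = keller_osserman k h H
  for k :: nat and h H :: "real \<Rightarrow> real" +
  fixes N :: nat and p :: "real \<Rightarrow> real"
  assumes k_le_N: "k \<le> N"
    and cont_p: "continuous_on {0..} p" and p_pos: "\<And>r. r \<ge> 0 \<Longrightarrow> p r > 0"
begin

definition C :: real where "C = real ((N - 1) choose (k - 1))"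
definition c :: real where "c = real k / C"

lemma C_pos: "C > 0"
  using k_le_N k_pos by (simp add: C_def)

lemma c_pos: "c > 0"
  using C_pos k_pos by (simp add: c_def)

lemma N_pos: "N > 0"
  using k_le_N k_pos by simp

lemma choose_N: "real ((N - 1) choose k) * real k = (real N - real k) * C"
  using choose_pred_step[OF k_pos k_le_N] by (simp add: C_def mult.commute)

text \<open>For a profile with \<open>S\<^sub>k = g\<^sup>k\<close> one has \<open>r\<^bsup>N-k\<^esup> \<phi>'(r)\<^sup>k = c \<integral>\<^sub>0\<^sup>r s\<^bsup>N-1\<^esup> g(s)\<^sup>k ds\<close>;
  rescaling the integral to \<open>[0,1]\<close> removes the singularity at the origin from \<open>(\<phi>'(r)/r)\<^sup>k\<close>.\<close>

definition E :: "(real \<Rightarrow> real) \<Rightarrow> real \<Rightarrow> real" where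
  "E g t = integral {0..1} (\<lambda>s. c * s ^ (N - 1) * g (t * s) ^ k)"

text \<open>This is \<phi>'(t)/t, the tangential eigenvalue, for the profile with S_k = g^k.\<close>

definition slope :: "(real \<Rightarrow> real) \<Rightarrow> real \<Rightarrow> real" where
  "slope g t = root k (E g t)"

text \<open>Not the derivative of \<open>slope g\<close> but t times it, the \<xi> of
  \<open>radial_profile\<close>: differentiate slope^k = E and use t E' = c g^k - N E. In this form
  it makes sense at t = 0.\<close>

definition slope' :: "(real \<Rightarrow> real) \<Rightarrow> real \<Rightarrow> real" where
  "slope' g t = slope g t * (c * g t ^ k - real N * E g t) / (real k * E g t)"

context
  fixes g :: "real \<Rightarrow> real"
  assumes cont_g: "continuous_on {0..} g" and g_pos: "\<And>t. t \<ge> 0 \<Longrightarrow> g t > 0"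
begin

lemma cont_scaled: "continuous_on ({0..} \<times> {0..1}) (\<lambda>(t, s). c * s ^ (N - 1) * g (t * s) ^ k)"
proof -
  have "continuous_on ({0..} \<times> {0..1}) (\<lambda>x. g (fst x * snd x))"
    by (rule continuous_on_compose2[OF cont_g]) (auto intro!: continuous_intros)
  then show ?thesis
    unfolding case_prod_unfold by (intro continuous_intros)
qed

lemma E_integrable:
  assumes "t \<ge> 0"
  shows "(\<lambda>s. c * s ^ (N - 1) * g (t * s) ^ k) integrable_on {0..1}"
proof (rule integrable_continuous_real)
  have "continuous_on {0..1} (\<lambda>s. g (t * s))"
    by (rule continuous_on_compose2[OF cont_g]) (use assms in \<open>auto intro!: continuous_intros\<close>)
  then show "continuous_on {0..1} (\<lambda>s. c * s ^ (N - 1) * g (t * s) ^ k)"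
    by (intro continuous_intros)
qed

lemma cont_E: "continuous_on {0..} (E g)"
  using integral_continuous_on_param[of "{0..}" 0 1 "\<lambda>t s. c * s ^ (N - 1) * g (t * s) ^ k"] cont_scaled
  by (simp add: E_def[abs_def] cbox_interval)

lemma cont_flux: "continuous_on {0..} (\<lambda>s. c * s ^ (N - 1) * g s ^ k)"
  by (intro continuous_intros cont_g)

text \<open>The substitution undoes the rescaling. The integral over [0,1] gives continuity up to 0,
  while this form gives differentiability for t > 0.\<close>

lemma E_eq_flux: "E g t = integral {0..t} (\<lambda>s. c * s ^ (N - 1) * g s ^ k) / t ^ N" if "t > 0"
proof -
  let ?f = "\<lambda>s. c * s ^ (N - 1) * g s ^ k"
  have "?f integrable_on {0..t}"
    by (intro integrable_continuous_real continuous_on_subset[OF cont_flux]) auto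
  then have "(?f has_integral integral {0..t} ?f) {0..t}"
    by (rule integrable_integral)
  moreover have "(\<lambda>x. x / t) ` {0..t} = {0..1}" using that by simp
  ultimately have "((\<lambda>s. ?f (t * s)) has_integral integral {0..t} ?f / t) {0..1}"
    using has_integral_stretch_real[of ?f "integral {0..t} ?f" 0 t t] that by simp
  then have "((\<lambda>s. inverse (t ^ (N - 1)) * ?f (t * s)) has_integral inverse (t ^ (N - 1)) * (integral {0..t} ?f / t)) {0..1}"
    by (rule has_integral_mult_right)
  moreover have "inverse (t ^ (N - 1)) * ?f (t * s) = c * s ^ (N - 1) * g (t * s) ^ k" for s
    using that by (simp add: power_mult_distrib)
  moreover have "inverse (t ^ (N - 1)) * (integral {0..t} ?f / t) = integral {0..t} ?f / t ^ N"
    using that N_pos by (cases N) (simp_all add: field_simps)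
  ultimately have "((\<lambda>s. c * s ^ (N - 1) * g (t * s) ^ k) has_integral integral {0..t} ?f / t ^ N) {0..1}"
    by (simp only:)
  then show ?thesis
    unfolding E_def by (rule integral_unique)
qed

text \<open>With g frozen at 0 what remains is the integral of s^(N-1), which is 1/N. The value
  makes the numerator of \<open>slope'\<close> vanish at the origin.\<close>

lemma E_0: "E g 0 = c * g 0 ^ k / real N"
proof -
  have "((\<lambda>s::real. s ^ (N - 1)) has_integral (1 ^ N / real N - 0 ^ N / real N)) {0..1}"
    using N_pos by (intro fundamental_theorem_of_calculus)
      (auto intro!: derivative_eq_intros simp flip: has_real_derivative_iff_has_vector_derivative)
  then have "((\<lambda>s::real. c * g 0 ^ k * s ^ (N - 1)) has_integral (c * g 0 ^ k * (1 / real N))) {0..1}"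
    using N_pos by (intro has_integral_mult_right) (simp add: power_0_left)
  moreover have "c * s ^ (N - 1) * g (0 * s) ^ k = c * g 0 ^ k * s ^ (N - 1)" for s
    by simp
  ultimately show ?thesis
    unfolding E_def by (simp only: integral_unique) simp
qed

lemma E_deriv: "(E g has_real_derivative (c * g t ^ k - real N * E g t) / t) (at t)" if "t > 0"
proof -
  let ?F = "\<lambda>t. integral {0..t} (\<lambda>s. c * s ^ (N - 1) * g s ^ k)"
  have "(?F has_real_derivative c * t ^ (N - 1) * g t ^ k) (at t)"
    by (rule integral_has_real_derivative_at[OF cont_flux that])
  then have "((\<lambda>t. ?F t / t ^ N) has_real_derivative
      (c * t ^ (N - 1) * g t ^ k * t ^ N - ?F t * (real N * t ^ (N - 1))) / (t ^ N * t ^ N)) (at t)"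
    using that by (auto intro!: derivative_eq_intros)
  moreover have "(c * t ^ (N - 1) * g t ^ k * t ^ N - ?F t * (real N * t ^ (N - 1))) / (t ^ N * t ^ N)
      = (c * g t ^ k - real N * E g t) / t"
    unfolding E_eq_flux[OF that] using that N_pos
    by (cases N) (simp_all add: field_simps)
  ultimately have "((\<lambda>t. ?F t / t ^ N) has_real_derivative (c * g t ^ k - real N * E g t) / t) (at t)"
    by simp
  then show ?thesis
    by (rule has_field_derivative_transform_within_open[where S = "{0<..}"])
      (use that E_eq_flux in auto)
qed

lemma E_pos: "E g t > 0" if "t \<ge> 0"
proof (cases "t = 0")
  case True
  then show ?thesis using E_0 c_pos g_pos[of 0] N_pos by simp
next
  case False
  with that have t: "t > 0" by simp
  let ?F = "\<lambda>t. integral {0..t} (\<lambda>s. c * s ^ (N - 1) * g s ^ k)"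
  have "?F 0 < ?F t"
  proof (rule DERIV_pos_imp_increasing_open[OF t, where f = ?F])
    show "continuous_on {0..t} ?F"
      by (rule continuous_on_subset[OF continuous_on_integral_atLeast[OF cont_flux]]) auto
    show "\<exists>y. (?F has_real_derivative y) (at x) \<and> y > 0" if "0 < x" for x
      using integral_has_real_derivative_at[OF cont_flux that] c_pos g_pos[of x] that
      by (intro exI[of _ "c * x ^ (N - 1) * g x ^ k"]) auto
  qed
  then show ?thesis using t by (simp add: E_eq_flux)
qed

lemma slope_pos: "t \<ge> 0 \<Longrightarrow> slope g t > 0"
  using E_pos k_pos by (simp add: slope_def)

lemma slope_power: "t \<ge> 0 \<Longrightarrow> slope g t ^ k = E g t"
  using E_pos[of t] k_pos by (simp add: slope_def)

lemma cont_slope: "continuous_on {0..} (slope g)"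
  unfolding slope_def[abs_def] by (intro continuous_intros cont_E)

lemma cont_slope': "continuous_on {0..} (slope' g)"
proof -
  have "real k * E g t \<noteq> 0" if "t \<ge> 0" for t using E_pos[OF that] k_pos by simp
  then show ?thesis
    unfolding slope'_def[abs_def] by (intro continuous_intros cont_E cont_slope cont_g) auto
qed

lemma slope'_0: "slope' g 0 = 0"
  using N_pos by (simp add: slope'_def E_0)

lemma slope_deriv: "(slope g has_real_derivative slope' g t / t) (at t)" if "t > 0"
proof -
  have E: "E g t > 0" using E_pos that by simp
  have "((\<lambda>t. root k (E g t)) has_real_derivative
      inverse (real k * root k (E g t) ^ (k - Suc 0)) * ((c * g t ^ k - real N * E g t) / t)) (at t)"
    using k_pos E by (intro DERIV_chain2[OF DERIV_real_root E_deriv[OF that]]) auto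
  moreover have "root k (E g t) ^ (k - Suc 0) = E g t / slope g t"
    using slope_power[of t] slope_pos[of t] that k_pos power_minus_mult[of k "slope g t"]
    by (simp add: slope_def field_simps)
  ultimately show ?thesis
    using E slope_pos[of t] that
    by (simp add: slope_def[abs_def] slope'_def field_simps)
qed

text \<open>The left side is S_k for the eigenvalue slope + slope' taken once and slope taken N - 1
  times.\<close>

lemma slope_equation:
  assumes "t \<ge> 0"
  shows "C * (slope g t + slope' g t) * slope g t ^ (k - 1) + real ((N - 1) choose k) * slope g t ^ k = g t ^ k"
proof -
  have E: "E g t > 0" using E_pos assms by simp
  \<comment> \<open>This is the ratio slope' / slope.\<close>
  define x where "x = (c * g t ^ k - real N * E g t) / (real k * E g t)"
  have "C * (slope g t + slope' g t) * slope g t ^ (k - 1) = C * (1 + x) * (slope g t ^ (k - 1) * slope g t)"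
    by (simp add: slope'_def x_def algebra_simps)
  also have "slope g t ^ (k - 1) * slope g t = E g t"
    using slope_power[OF assms] k_pos power_minus_mult[of k "slope g t"] by simp
  also have "C * (1 + x) * E g t = C * E g t + g t ^ k - C * real N / real k * E g t"
    using E k_pos C_pos by (simp add: c_def x_def field_simps)
  \<comment> \<open>Both C N / k and C + binom(N-1,k) equal binom(N,k).\<close>
  also have "C * real N / real k * E g t = C * E g t + real ((N - 1) choose k) * E g t"
  proof -
    have "C * real N / real k = C + real ((N - 1) choose k)"
      using choose_N k_pos by (simp add: field_simps)
    then show ?thesis by (simp only: distrib_right)
  qed
  finally show ?thesis using slope_power[OF assms] by simp
qed

text \<open>With x = slope' / slope, S_j equals binom(N-1,j-1) (x + N/j) slope^j. Positivity of g
  gives x > -N/k, and N/k \<le> N/j for j \<le> k.\<close>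

lemma slope_garding:
  assumes "t \<ge> 0" "1 \<le> j" "j \<le> k"
  shows "real ((N - 1) choose (j - 1)) * (slope g t + slope' g t) * slope g t ^ (j - 1)
    + real ((N - 1) choose j) * slope g t ^ j > 0"
proof -
  let ?b = "real ((N - 1) choose (j - 1))"
  define x where "x = (c * g t ^ k - real N * E g t) / (real k * E g t)"
  have E: "E g t > 0" and s: "slope g t > 0" using E_pos slope_pos assms by simp_all
  have "- (real N / real k) < x"
    using E k_pos c_pos g_pos[OF assms(1)] by (simp add: x_def field_simps)
  moreover have "real N / real k \<le> real N / real j"
    using assms by (intro divide_left_mono) auto
  ultimately have x: "x + real N / real j > 0" by linarith
  have "?b * (slope g t + slope' g t) * slope g t ^ (j - 1) = ?b * (1 + x) * (slope g t ^ (j - 1) * slope g t)"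
    by (simp add: slope'_def x_def algebra_simps)
  also have "slope g t ^ (j - 1) * slope g t = slope g t ^ j"
    using assms power_minus_mult[of j "slope g t"] by simp
  finally have e1: "?b * (slope g t + slope' g t) * slope g t ^ (j - 1) = ?b * (1 + x) * slope g t ^ j" .
  have e2: "real ((N - 1) choose j) = (real N / real j - 1) * ?b"
    using choose_pred_step[of j N] assms k_le_N by (simp add: field_simps)
  have "?b * (slope g t + slope' g t) * slope g t ^ (j - 1)
    + real ((N - 1) choose j) * slope g t ^ j = ?b * (x + real N / real j) * slope g t ^ j"
    unfolding e1 e2 by (simp add: algebra_simps)
  moreover have "?b > 0" using assms k_le_N by simp
  ultimately show ?thesis using x s by simp
qed

text \<open>Applied to the Picard iterates and later to their limit, for which the integral formula
  is known only at nonnegative r.\<close>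

lemma radial_profile_slope:
  assumes y: "\<And>r. r \<ge> 0 \<Longrightarrow> y r = a + integral {0..r} (\<lambda>t. t * slope g t)"
  shows "radial_profile y (slope g) (slope' g)"
proof
  have cont: "continuous_on {0..} (\<lambda>t. t * slope g t)" by (intro continuous_intros cont_slope)
  show "(y has_real_derivative r * slope g r) (at r)" if "r > 0" for r
  proof (rule has_field_derivative_transform_within_open[where S = "{0<..}"])
    show "((\<lambda>r. a + integral {0..r} (\<lambda>t. t * slope g t)) has_real_derivative r * slope g r) (at r)"
      using integral_has_real_derivative_at[OF cont that] by (auto intro!: derivative_eq_intros)
  qed (use that y in auto)
  show "(y has_real_derivative 0) (at 0 within {0..})"
  proof -
    have "((\<lambda>r. integral {0..r} (\<lambda>t. t * slope g t)) has_real_derivative 0 * slope g 0) (at 0 within {0..1})"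
      by (intro integral_has_real_derivative continuous_on_subset[OF cont]) auto
    moreover have "at 0 within {0..1::real} = at 0 within {0..}"
      by (rule at_within_nhd[of _ "{- 1<..<1}"]) auto
    ultimately have "((\<lambda>r. a + integral {0..r} (\<lambda>t. t * slope g t)) has_real_derivative 0) (at 0 within {0..})"
      by (auto intro!: derivative_eq_intros)
    then show ?thesis
      by (rule has_field_derivative_transform_within[where d = 1]) (auto simp: y)
  qed
  show "(slope g has_real_derivative slope' g r / r) (at r)" if "r > 0" for r
    using slope_deriv that .
qed (rule cont_slope cont_slope' slope'_0)+

end

lemma E_mono:
  assumes "continuous_on {0..} g1" "continuous_on {0..} g2" "\<And>s. s \<ge> 0 \<Longrightarrow> 0 < g1 s"
    "\<And>s. s \<ge> 0 \<Longrightarrow> g1 s \<le> g2 s" "t \<ge> 0"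
  shows "E g1 t \<le> E g2 t"
  unfolding E_def
proof (rule integral_le)
  have g2: "0 < g2 s" if "s \<ge> 0" for s using assms(3,4)[OF that] by linarith
  show "(\<lambda>s. c * s ^ (N - 1) * g1 (t * s) ^ k) integrable_on {0..1}"
    using assms by (intro E_integrable)
  show "(\<lambda>s. c * s ^ (N - 1) * g2 (t * s) ^ k) integrable_on {0..1}"
    using assms g2 by (intro E_integrable)
  show "c * s ^ (N - 1) * g1 (t * s) ^ k \<le> c * s ^ (N - 1) * g2 (t * s) ^ k" if "s \<in> {0..1}" for s
    using that c_pos assms(3)[of "t * s"] assms(4)[of "t * s"] assms(5)
    by (intro mult_left_mono power_mono) auto
qed

end

lemma continuous_on_Icc_le_bound:
  fixes f :: "real \<Rightarrow> real"
  assumes "continuous_on {a..b} f"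
  obtains M where "\<And>t. t \<in> {a..b} \<Longrightarrow> f t \<le> M"
  using bounded_imp_bdd_above[OF compact_imp_bounded[OF compact_continuous_image[OF assms compact_Icc]]]
  unfolding bdd_above_def by blast

section \<open>Picard iteration and existence of an entire solution\<close>

context hessian_ode
begin

definition rhs :: "(real \<Rightarrow> real) \<Rightarrow> real \<Rightarrow> real" where
  "rhs v s = p s * h (v s)"

text \<open>Solves the radial equation with right side p h(v): the factor t turns the slope back
  into a derivative. The value 1 at the origin keeps the arguments of \<open>h\<close>
  positive.\<close>

definition picard :: "(real \<Rightarrow> real) \<Rightarrow> real \<Rightarrow> real" where
  "picard v r = 1 + integral {0..r} (\<lambda>t. t * slope (rhs v) t)"

context
  fixes v :: "real \<Rightarrow> real"
  assumes cont_v: "continuous_on {0..} v" and v_ge_1: "\<And>t. t \<ge> 0 \<Longrightarrow> v t \<ge> 1"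
begin

lemma cont_rhs: "continuous_on {0..} (rhs v)"
proof -
  have "continuous_on {0..} (\<lambda>s. h (v s))"
    by (rule continuous_on_compose2[OF cont_h cont_v]) (use v_ge_1 in \<open>auto intro: order_trans[OF zero_le_one]\<close>)
  then show ?thesis unfolding rhs_def[abs_def] by (intro continuous_intros cont_p)
qed

lemma rhs_pos: "t \<ge> 0 \<Longrightarrow> rhs v t > 0"
  using p_pos[of t] h_pos[of "v t"] v_ge_1[of t] by (simp add: rhs_def)

lemma radial_profile_picard: "radial_profile (picard v) (slope (rhs v)) (slope' (rhs v))"
  by (rule radial_profile_slope[OF cont_rhs rhs_pos, of _ 1]) (auto simp: picard_def)

lemma cont_picard: "continuous_on {0..} (picard v)"
  unfolding picard_def[abs_def]
  by (intro continuous_intros continuous_on_integral_atLeast cont_slope[OF cont_rhs rhs_pos]) auto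

lemma picard_ge_1: "t \<ge> 0 \<Longrightarrow> picard v t \<ge> 1"
  unfolding picard_def using slope_pos[OF cont_rhs rhs_pos]
  by (auto intro!: integral_nonneg integrable_continuous_real continuous_intros
      continuous_on_subset[OF cont_slope[OF cont_rhs rhs_pos]] simp: less_imp_le)

end

lemma picard_mono:
  assumes "continuous_on {0..} v1" "\<And>t. t \<ge> 0 \<Longrightarrow> v1 t \<ge> 1" "continuous_on {0..} v2"
    "\<And>t. t \<ge> 0 \<Longrightarrow> v1 t \<le> v2 t" "r \<ge> 0"
  shows "picard v1 r \<le> picard v2 r"
proof -
  have v2: "v2 t \<ge> 1" if "t \<ge> 0" for t using assms(2,4)[OF that] by linarith
  note r1 = cont_rhs[OF assms(1,2)] rhs_pos[OF assms(1,2)]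
  note r2 = cont_rhs[OF assms(3) v2] rhs_pos[OF assms(3) v2]
  have "slope (rhs v1) t \<le> slope (rhs v2) t" if "t \<ge> 0" for t
  proof -
    have "rhs v1 s \<le> rhs v2 s" if "s \<ge> 0" for s
      using assms(2)[OF that] assms(4)[OF that] p_pos[OF that]
      by (auto simp: rhs_def intro!: mult_left_mono mono_onD[OF mono_h])
    then have "E (rhs v1) t \<le> E (rhs v2) t"
      using r1 r2 that by (intro E_mono) auto
    then show ?thesis using k_pos by (simp add: slope_def)
  qed
  then show ?thesis
    unfolding picard_def using assms(5)
    by (intro add_left_mono integral_le integrable_continuous_real continuous_intros
        continuous_on_subset[OF cont_slope[OF r1]] continuous_on_subset[OF cont_slope[OF r2]] mult_left_mono) auto
qed

text \<open>Multiplying the equation by \<open>y'\<close> gives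
  \<open>(y'\<^bsup>k+1\<^esup>)' \<le> M (H(y))'\<close> on \<open>[0,R]\<close>.\<close>

lemma picard_bound:
  assumes "R \<ge> 0"
  obtains B where "\<And>v r. continuous_on {0..} v \<Longrightarrow> (\<And>t. t \<ge> 0 \<Longrightarrow> v t \<ge> 1) \<Longrightarrow>
    (\<And>t. t \<ge> 0 \<Longrightarrow> v t \<le> picard v t) \<Longrightarrow> r \<in> {0..R} \<Longrightarrow> picard v r \<le> B"
proof -
  \<comment> \<open>This coefficient is left over when (k+1) y'' y'^k is estimated through the
    equation; \<open>M\<close> below is a nonnegative bound for it.\<close>
  have "continuous_on {0..R} (\<lambda>t. (real k + 1) / C * t ^ (k - 1) * p t ^ k)"
    by (intro continuous_intros continuous_on_subset[OF cont_p]) auto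
  then obtain M0 where M0: "\<And>t. t \<in> {0..R} \<Longrightarrow> (real k + 1) / C * t ^ (k - 1) * p t ^ k \<le> M0"
    by (rule continuous_on_Icc_le_bound) blast
  define M where "M = max M0 0"
  have M: "(real k + 1) / C * t ^ (k - 1) * p t ^ k \<le> M" if "t \<in> {0..R}" for t
    using M0[OF that] by (simp add: M_def)
  have M_nonneg: "M \<ge> 0" by (simp add: M_def)
  \<comment> \<open>The division by k + 1 cancels the same factor inside \<open>w\<close>, so that
    the energy estimate becomes y' \<le> L w(y).\<close>
  define L where "L = root (k + 1) (M / (real k + 1))"
  have L_nonneg: "L \<ge> 0" using M_nonneg by (simp add: L_def)
  \<comment> \<open>\<open>B\<close> is fixed before \<open>v\<close> is introduced and depends on R
    only, so it bounds all iterates at once.\<close>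
  obtain B where B: "B \<ge> 1" "G B > G 1 + L * R" using G_unbounded by blast
  show thesis
  proof (rule that)
    fix v r
    assume v: "continuous_on {0..} v" "\<And>t. t \<ge> 0 \<Longrightarrow> v t \<ge> 1"
      and le: "\<And>t. t \<ge> 0 \<Longrightarrow> v t \<le> picard v t" and r: "r \<in> {0..R}"
    let ?y = "picard v" and ?g = "rhs v"
    note g = cont_rhs[OF v] rhs_pos[OF v]
    interpret radial_profile ?y "slope ?g" "slope' ?g"
      by (rule radial_profile_picard[OF v])
    note cont_y = cont_picard[OF v] and y_ge_1 = picard_ge_1[OF v]
    have y_H: "(t * slope ?g t) ^ (k + 1) \<le> M * H (?y t)" if t: "t \<in> {0..R}" for t
    proof -
      have "M * H (?y 0) - (0 * slope ?g 0) ^ (k + 1) \<le> M * H (?y t) - (t * slope ?g t) ^ (k + 1)"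
      proof (rule DERIV_nonneg_imp_increasing_open[where f = "\<lambda>t. M * H (?y t) - (t * slope ?g t) ^ (k + 1)"])
        have "continuous_on {0..} (\<lambda>t. H (?y t))"
          by (rule continuous_on_compose2[OF cont_H cont_y]) (use y_ge_1 in \<open>auto intro: order_trans[OF zero_le_one]\<close>)
        then have "continuous_on {0..} (\<lambda>t. M * H (?y t) - (t * slope ?g t) ^ (k + 1))"
          by (intro continuous_intros cont_\<psi>)
        then show "continuous_on {0..t} (\<lambda>t. M * H (?y t) - (t * slope ?g t) ^ (k + 1))"
          by (rule continuous_on_subset) auto
        show "\<exists>d. ((\<lambda>t. M * H (?y t) - (t * slope ?g t) ^ (k + 1)) has_real_derivative d) (at s) \<and> 0 \<le> d"
          if s: "0 < s" "s < t" for s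
        proof (intro exI conjI)
          let ?y' = "s * slope ?g s" and ?y'' = "slope ?g s + slope' ?g s"
          have ys: "?y s > 0" using y_ge_1[of s] s by simp
          have "((\<lambda>t. t * slope ?g t) has_real_derivative ?y'') (at s)"
            using DERIV_mult[OF DERIV_ident \<psi>_deriv[OF s(1)]] s by (simp add: add.commute)
          from DERIV_power[OF this, of "k + 1"]
          have "((\<lambda>t. (t * slope ?g t) ^ (k + 1)) has_real_derivative (real k + 1) * (?y'' * ?y' ^ k)) (at s)"
            by (simp add: add.commute)
          then show "((\<lambda>t. M * H (?y t) - (t * slope ?g t) ^ (k + 1)) has_real_derivative
              M * (h (?y s) ^ k * ?y') - (real k + 1) * (?y'' * ?y' ^ k)) (at s)"
            by (intro derivative_intros DERIV_cmult DERIV_chain2[OF H_deriv[OF ys] \<phi>_deriv[OF s(1)]])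
          have y'_pos: "?y' > 0" using slope_pos[OF g, of s] s by simp
          \<comment> \<open>The nonnegative term binom(N-1,k) slope^k of the equation is
            dropped.\<close>
          have "C * ?y'' * slope ?g s ^ (k - 1) \<le> ?g s ^ k"
            using slope_equation[OF g, of s] slope_pos[OF g, of s] s
            by (smt (verit) mult_nonneg_nonneg of_nat_0_le_iff zero_le_power)
          \<comment> \<open>The condition v \<le> \<open>picard v\<close> enters here: replacing
            h(v) by h(y) leads to a multiple of the derivative of H(y).\<close>
          also have "\<dots> \<le> (p s * h (?y s)) ^ k"
            unfolding rhs_def using s v(2)[of s] le[of s] p_pos[of s] h_nonneg[of "v s"]
            by (intro power_mono mult_left_mono mono_onD[OF mono_h]) auto
          finally have *: "C * ?y'' * slope ?g s ^ (k - 1) \<le> (p s * h (?y s)) ^ k" .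
          let ?z = "s ^ (k - 1) * ((real k + 1) / C * ?y')"
          have "(real k + 1) * (?y'' * ?y' ^ k) = (real k + 1) * (?y'' * (?y' ^ (k - 1) * ?y'))"
            using k_pos power_minus_mult[of k ?y'] by simp
          also have "\<dots> = C * ?y'' * slope ?g s ^ (k - 1) * ?z"
            using C_pos by (simp add: power_mult_distrib)
          also have "\<dots> \<le> (p s * h (?y s)) ^ k * ?z"
            using * s y'_pos C_pos by (intro mult_right_mono) auto
          also have "\<dots> = ((real k + 1) / C * s ^ (k - 1) * p s ^ k) * (h (?y s) ^ k * ?y')"
            by (simp add: power_mult_distrib)
          also have "\<dots> \<le> M * (h (?y s) ^ k * ?y')"
            using M[of s] s t y'_pos h_nonneg[of "?y s"] ys by (intro mult_right_mono) auto
          finally show "0 \<le> M * (h (?y s) ^ k * ?y') - (real k + 1) * (?y'' * ?y' ^ k)"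
            by simp
        qed
      qed (use t in auto)
      moreover have "0 \<le> M * H (?y 0)"
        using M_nonneg H_pos[of "?y 0"] y_ge_1[of 0] by simp
      ultimately show ?thesis by simp
    qed
    have "G (?y r) - G (?y 0) \<le> L * r - L * 0"
    proof (rule G_compare[where y = ?y and y' = "\<lambda>t. t * slope ?g t" and Q = "\<lambda>t. L * t" and q = "\<lambda>_. L"])
      show "continuous_on {0..r} ?y" by (rule continuous_on_subset[OF cont_y]) auto
      show "t * slope ?g t \<le> L * w (?y t)" if "0 < t" "t < r" for t
      proof -
        have "t * slope ?g t = root (k + 1) ((t * slope ?g t) ^ (k + 1))"
          using slope_pos[OF g, of t] that by (subst real_root_power_cancel) auto
        also have "\<dots> \<le> root (k + 1) (M * H (?y t))"
          using y_H[of t] that r by (subst real_root_le_iff) auto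
        also have "\<dots> = root (k + 1) (M / (real k + 1) * ((real k + 1) * H (?y t)))"
          by simp
        also have "\<dots> = L * w (?y t)"
          unfolding L_def w_def by (rule real_root_mult)
        finally show ?thesis .
      qed
    qed (use r y_ge_1 \<phi>_deriv in \<open>auto intro!: continuous_intros derivative_eq_intros\<close>)
    moreover have "L * r \<le> L * R" using r L_nonneg by (intro mult_left_mono) auto
    moreover have "?y 0 = 1" by (simp add: picard_def)
    ultimately have "G (?y r) < G B" using B(2) by simp
    then show "?y r \<le> B"
      using G_mono[of B "?y r"] B(1) by (meson less_le_not_le linorder_le_cases)
  qed
qed

primrec iter :: "nat \<Rightarrow> real \<Rightarrow> real" where
  "iter 0 = (\<lambda>_. 1)"
| "iter (Suc n) = picard (iter n)"

lemma cont_iter: "continuous_on {0..} (iter n)"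
  and iter_ge_1: "t \<ge> 0 \<Longrightarrow> iter n t \<ge> 1"
proof (induction n arbitrary: t)
  case (Suc n)
  { case 1 show ?case using cont_picard Suc by simp }
  { case 2 then show ?case using picard_ge_1 Suc by simp }
qed simp_all

text \<open>Supplies the condition v \<le> \<open>picard v\<close> of \<open>picard_bound\<close>.
  It starts from \<open>picard_ge_1\<close> and propagates through the monotonicity of
  \<open>h\<close>.\<close>

lemma iter_le_Suc: "t \<ge> 0 \<Longrightarrow> iter n t \<le> iter (Suc n) t"
proof (induction n arbitrary: t)
  case 0
  show ?case using iter_ge_1[OF 0, of 1] by simp
next
  case (Suc n)
  show ?case
    using picard_mono[OF cont_iter iter_ge_1 cont_iter Suc.IH Suc.prems] by simp
qed

lemma iter_bound:
  assumes "R \<ge> 0"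
  obtains B where "B \<ge> 1" "\<And>n t. t \<in> {0..R} \<Longrightarrow> iter n t \<le> B"
proof -
  obtain B where B: "\<And>v r. continuous_on {0..} v \<Longrightarrow> (\<And>t. t \<ge> 0 \<Longrightarrow> v t \<ge> 1) \<Longrightarrow>
    (\<And>t. t \<ge> 0 \<Longrightarrow> v t \<le> picard v t) \<Longrightarrow> r \<in> {0..R} \<Longrightarrow> picard v r \<le> B"
    using picard_bound[OF assms] by metis
  have "iter n t \<le> max B 1" if "t \<in> {0..R}" for n t
  proof (cases n)
    case (Suc m)
    then show ?thesis
      using B[OF cont_iter iter_ge_1 _ that, of m] iter_le_Suc[of _ m] by (auto simp: le_max_iff_disj)
  qed simp
  then show thesis using that[of "max B 1"] by simp
qed

text \<open>The increasing bounded iterates converge pointwise. Dominated convergence is used twice,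
  inside \<open>E\<close> and then in the outer integral.\<close>

lemma picard_fixed_point:
  obtains y where "continuous_on {0..} y" "\<And>t. t \<ge> 0 \<Longrightarrow> y t \<ge> 1" "\<And>t. t \<ge> 0 \<Longrightarrow> y t = picard y t"
proof -
  define y where "y t = lim (\<lambda>n. iter n t)" for t
  have lim_y: "(\<lambda>n. iter n t) \<longlonglongrightarrow> y t" if t: "t \<ge> 0" for t
  proof -
    have "incseq (\<lambda>n. iter n t)" using iter_le_Suc[OF t] by (auto intro: incseq_SucI)
    moreover obtain B where "\<And>n s. s \<in> {0..t} \<Longrightarrow> iter n s \<le> B" using iter_bound[OF t] by metis
    then have "iter n t \<le> B" for n using t by simp
    ultimately obtain l where "(\<lambda>n. iter n t) \<longlonglongrightarrow> l" by (metis incseq_convergent)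
    then show ?thesis unfolding y_def by (simp add: limI)
  qed
  have y_ge_1: "y t \<ge> 1" if "t \<ge> 0" for t
    using lim_y[OF that] by (rule LIMSEQ_le_const) (use iter_ge_1[OF that] in auto)
  have rhs_lim: "(\<lambda>n. rhs (iter n) t) \<longlonglongrightarrow> rhs y t" if "t \<ge> 0" for t
  proof -
    have "(\<lambda>n. h (iter n t)) \<longlonglongrightarrow> h (y t)"
    proof (rule continuous_on_tendsto_compose[OF cont_h lim_y[OF that]])
      show "y t \<in> {0..}" using y_ge_1[OF that] by simp
      show "\<forall>\<^sub>F n in sequentially. iter n t \<in> {0..}"
        using order_trans[OF zero_le_one iter_ge_1[OF that]] by simp
    qed
    then show ?thesis unfolding rhs_def by (rule tendsto_mult_left)
  qed
  \<comment> \<open>Integrability of the limit is part of the claim, because continuity of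
    \<open>y\<close> is not yet available.\<close>
  have *: "(\<lambda>t. t * slope (rhs y) t) integrable_on {0..R}
      \<and> (\<lambda>n. integral {0..R} (\<lambda>t. t * slope (rhs (iter n)) t)) \<longlonglongrightarrow> integral {0..R} (\<lambda>t. t * slope (rhs y) t)"
    if R: "R \<ge> 0" for R
  proof -
    obtain B where B: "B \<ge> 1" "\<And>n t. t \<in> {0..R} \<Longrightarrow> iter n t \<le> B" using iter_bound[OF R] by metis
    obtain P where P: "\<And>t. t \<in> {0..R} \<Longrightarrow> p t \<le> P"
      by (rule continuous_on_Icc_le_bound[OF continuous_on_subset[OF cont_p], of 0 R]) auto
    have "P > 0" using P[of 0] p_pos[of 0] R by force
    \<comment> \<open>A uniform bound for the integrands of \<open>E\<close>: the iterates stay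
      below B, \<open>h\<close> is monotone, and s^(N-1) \<le> 1.\<close>
    define K where "K = c * (P * h B) ^ k"
    have hB: "h B \<ge> 0" using B(1) h_nonneg by simp
    have K: "0 \<le> c * s ^ (N - 1) * rhs (iter n) (t * s) ^ k" "c * s ^ (N - 1) * rhs (iter n) (t * s) ^ k \<le> K"
      if "s \<in> {0..1}" "t \<in> {0..R}" for s t n
    proof -
      have "t * s \<le> R * 1" using that by (intro mult_mono) auto
      then have ts: "t * s \<in> {0..R}" using that by auto
      have "h (iter n (t * s)) \<le> h B"
        using B ts iter_ge_1[of "t * s" n] by (intro mono_onD[OF mono_h]) auto
      then have "rhs (iter n) (t * s) \<le> P * h B"
        unfolding rhs_def using P[OF ts] \<open>P > 0\<close> ts iter_ge_1[of "t * s" n]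
        by (intro mult_mono h_nonneg) auto
      moreover have r: "rhs (iter n) (t * s) > 0"
        using rhs_pos[OF cont_iter iter_ge_1] ts by simp
      ultimately have "rhs (iter n) (t * s) ^ k \<le> (P * h B) ^ k" by (intro power_mono) auto
      moreover have "s ^ (N - 1) \<le> 1" using that by (intro power_le_one) auto
      ultimately have "s ^ (N - 1) * rhs (iter n) (t * s) ^ k \<le> 1 * (P * h B) ^ k"
        using that r by (intro mult_mono) auto
      then show "c * s ^ (N - 1) * rhs (iter n) (t * s) ^ k \<le> K"
        unfolding K_def mult.assoc using c_pos by (intro mult_left_mono) auto
      show "0 \<le> c * s ^ (N - 1) * rhs (iter n) (t * s) ^ k" using c_pos that r by simp
    qed
    have E_lim: "(\<lambda>n. E (rhs (iter n)) t) \<longlonglongrightarrow> E (rhs y) t" if "t \<in> {0..R}" for t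
      unfolding E_def
    proof (rule dominated_convergence(2)[where h = "\<lambda>_. K"])
      show "(\<lambda>s. c * s ^ (N - 1) * rhs (iter n) (t * s) ^ k) integrable_on {0..1}" for n
        using that by (intro E_integrable cont_rhs rhs_pos cont_iter iter_ge_1) auto
      show "norm (c * s ^ (N - 1) * rhs (iter n) (t * s) ^ k) \<le> K" if "s \<in> {0..1}" for n s
        using K[OF that \<open>t \<in> {0..R}\<close>, of n] by simp
      show "(\<lambda>n. c * s ^ (N - 1) * rhs (iter n) (t * s) ^ k) \<longlonglongrightarrow> c * s ^ (N - 1) * rhs y (t * s) ^ k"
        if "s \<in> {0..1}" for s
        using that \<open>t \<in> {0..R}\<close> by (intro tendsto_intros rhs_lim) auto
    qed auto
    have E_le: "E (rhs (iter n)) t \<le> K" if "t \<in> {0..R}" for n t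
    proof -
      have "E (rhs (iter n)) t \<le> integral {0..1} (\<lambda>s::real. K)"
        unfolding E_def using that K by (intro integral_le E_integrable cont_rhs rhs_pos cont_iter iter_ge_1) auto
      then show ?thesis by simp
    qed
    have cont_n: "continuous_on {0..} (slope (rhs (iter n)))" for n
      by (intro cont_slope cont_rhs rhs_pos cont_iter iter_ge_1)
    have pos_n: "slope (rhs (iter n)) t > 0" if "t \<ge> 0" for n t
      using that by (intro slope_pos cont_rhs rhs_pos cont_iter iter_ge_1)
    have 1: "(\<lambda>t. t * slope (rhs (iter n)) t) integrable_on {0..R}" for n
      by (intro integrable_continuous_real continuous_intros continuous_on_subset[OF cont_n]) auto
    have 2: "norm (t * slope (rhs (iter n)) t) \<le> R * root k K" if "t \<in> {0..R}" for n t
    proof -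
      have "slope (rhs (iter n)) t \<le> root k K"
        using E_le[OF that] k_pos by (simp add: slope_def)
      then have "t * slope (rhs (iter n)) t \<le> R * root k K"
        using that pos_n[of t n] by (intro mult_mono) auto
      then show ?thesis using that pos_n[of t n] by (simp add: abs_mult)
    qed
    have 3: "(\<lambda>n. t * slope (rhs (iter n)) t) \<longlonglongrightarrow> t * slope (rhs y) t" if "t \<in> {0..R}" for t
      unfolding slope_def by (intro tendsto_intros E_lim[OF that])
    show ?thesis
      using dominated_convergence[OF 1 _ 2 3] by (simp add: integrable_const_ivl)
  qed
  have fixed: "y R = picard y R" if "R \<ge> 0" for R
  proof -
    have "(\<lambda>n. iter (Suc n) R) \<longlonglongrightarrow> picard y R"
      unfolding iter.simps picard_def using *[OF that] by (intro tendsto_intros) auto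
    then show ?thesis using lim_y[OF that] LIMSEQ_Suc LIMSEQ_unique by blast
  qed
  \<comment> \<open>Continuity comes from the fixed-point equation, which makes \<open>y\<close> an
    indefinite integral, and not from the pointwise limit.\<close>
  have "continuous_on {0..} y"
  proof -
    have "continuous_on {0..R} y" for R
    proof (cases "R \<ge> 0")
      case True
      have "continuous_on {0..R} (\<lambda>r. 1 + integral {0..r} (\<lambda>t. t * slope (rhs y) t))"
        using *[OF True] by (intro continuous_intros indefinite_integral_continuous_1) auto
      then show ?thesis
        by (rule continuous_on_cong[THEN iffD1, rotated 2]) (auto simp: fixed picard_def)
    qed simp
    then have "continuous (at x within {0..}) y" if "x \<ge> 0" for x
    proof -
      have "continuous (at x within {0..x + 1}) y"
        using \<open>continuous_on {0..x + 1} y\<close> that by (auto simp: continuous_on_eq_continuous_within)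
      moreover have "at x within {0..x + 1} = at x within {0..}"
        by (rule at_within_nhd[of _ "{x - 1<..<x + 1}"]) auto
      ultimately show ?thesis by simp
    qed
    then show ?thesis by (simp add: continuous_on_eq_continuous_within)
  qed
  then show thesis using that y_ge_1 fixed by blast
qed

lemma exists_entire_solution:
  assumes N: "N = CARD('n::finite)"
  obtains u :: "real^'n \<Rightarrow> real"
  where "u \<in> admissible k" "\<And>x. u x \<ge> 1" "radial u" "solves_hessian_eq k p h u"
proof -
  obtain y where y: "continuous_on {0..} y" "\<And>t. t \<ge> 0 \<Longrightarrow> y t \<ge> 1" "\<And>t. t \<ge> 0 \<Longrightarrow> y t = picard y t"
    using picard_fixed_point by blast
  note g = cont_rhs[OF y(1,2)] rhs_pos[OF y(1,2)]
  let ?s = "slope (rhs y)" and ?s' = "slope' (rhs y)"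
  interpret radial_profile y ?s ?s'
    by (rule radial_profile_slope[OF g, where a = 1]) (auto simp: y(3) picard_def)
  let ?u = "\<lambda>x::real^'n. y (norm x)"
  have S: "elem_sym j (eigenvalues (hessian ?u x)) =
      real ((N - 1) choose (j - 1)) * (?s (norm x) + ?s' (norm x)) * ?s (norm x) ^ (j - 1)
      + real ((N - 1) choose j) * ?s (norm x) ^ j" if "j \<ge> 1" for j x
  proof -
    \<comment> \<open>At x = 0 the left side is 0 by division by zero, in agreement with the
      vanishing of \<open>slope'\<close> there.\<close>
    have "?s' (norm x) / (norm x)\<^sup>2 * (norm x)\<^sup>2 = ?s' (norm x)"
      using slope'_0[OF g] by (cases "x = 0") auto
    then show ?thesis
      unfolding hessian_profile elem_sym_eigenvalues_rank_one_update[OF that] N by simp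
  qed
  have "?u \<in> admissible k"
    unfolding admissible_def garding_cone_def
    using C2_fun_profile slope_garding[OF g] by (auto simp: S)
  moreover have "solves_hessian_eq k p h ?u"
    unfolding solves_hessian_eq_def
  proof
    fix x :: "real^'n"
    have "elem_sym k (eigenvalues (hessian ?u x)) = rhs y (norm x) ^ k"
      unfolding S[OF k_pos] using slope_equation[OF g, of "norm x"] by (simp add: C_def)
    then show "root k (elem_sym k (eigenvalues (hessian ?u x))) = p (norm x) * h (?u x)"
      using g(2)[of "norm x"] k_pos by (simp add: real_root_power_cancel rhs_def)
  qed
  moreover have "radial ?u" unfolding radial_def by blast
  ultimately show thesis using that[of ?u] y(2) by simp
qed

end

subsection \<open>Growth of radial solutions\<close>

text \<open>Serves to pass from y^(k+1) \<le> a^(k+1) + b^(k+1) to y \<le> a + b.\<close>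

lemma power_Suc_superadditive:
  fixes a b :: real
  assumes "a \<ge> 0" "b \<ge> 0"
  shows "a ^ Suc n + b ^ Suc n \<le> (a + b) ^ Suc n"
proof (induction n)
  case (Suc n)
  have "a ^ Suc (Suc n) + b ^ Suc (Suc n) \<le> (a + b) * (a ^ Suc n + b ^ Suc n)"
    using assms by (simp add: algebra_simps)
  also have "\<dots> \<le> (a + b) * (a + b) ^ Suc n"
    using Suc assms by (intro mult_left_mono) auto
  finally show ?case by simp
qed simp

locale hessian_solution = hessian_ode k h H N p
  for k :: nat and h H :: "real \<Rightarrow> real" and N :: nat and p :: "real \<Rightarrow> real" +
  fixes \<phi> \<phi>' \<phi>'' :: "real \<Rightarrow> real"
  assumes deriv: "\<And>t. (\<phi> has_real_derivative \<phi>' t) (at t)"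
    and deriv2: "\<And>t. (\<phi>' has_real_derivative \<phi>'' t) (at t)"
    and deriv_0: "\<phi>' 0 = 0"
    and \<phi>_pos: "\<And>r. r \<ge> 0 \<Longrightarrow> \<phi> r > 0"
    and S1_pos: "\<And>r. r > 0 \<Longrightarrow> \<phi>'' r + real (N - 1) * (\<phi>' r / r) > 0"
    and equation: "\<And>r. r > 0 \<Longrightarrow> C * \<phi>'' r * (\<phi>' r / r) ^ (k - 1)
      + real ((N - 1) choose k) * (\<phi>' r / r) ^ k = (p r * h (\<phi> r)) ^ k"
begin

lemma cont_\<phi>: "continuous_on S \<phi>" and cont_\<phi>': "continuous_on S \<phi>'"
  using deriv deriv2 by (meson DERIV_isCont continuous_at_imp_continuous_on)+

text \<open>Positivity of S_1 says that r^(N-1) \<phi>' has positive derivative, and this function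
  vanishes at 0.\<close>

lemma \<phi>'_pos: "\<phi>' r > 0" if "r > 0"
proof -
  have "0 ^ (N - 1) * \<phi>' 0 < r ^ (N - 1) * \<phi>' r"
  proof (rule DERIV_pos_imp_increasing_open[OF that, where f = "\<lambda>r. r ^ (N - 1) * \<phi>' r"])
    show "continuous_on {0..r} (\<lambda>r. r ^ (N - 1) * \<phi>' r)"
      by (intro continuous_intros cont_\<phi>')
    show "\<exists>d. ((\<lambda>r. r ^ (N - 1) * \<phi>' r) has_real_derivative d) (at x) \<and> d > 0" if "0 < x" for x
    proof (intro exI conjI)
      show "((\<lambda>r. r ^ (N - 1) * \<phi>' r) has_real_derivative
          real (N - 1) * x ^ (N - 1 - 1) * \<phi>' x + x ^ (N - 1) * \<phi>'' x) (at x)"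
        by (auto intro!: derivative_eq_intros deriv2)
      have "real (N - 1) * x ^ (N - 1 - 1) = real (N - 1) * x ^ (N - 1) / x"
        using that by (cases "N - 1") auto
      then have "real (N - 1) * x ^ (N - 1 - 1) * \<phi>' x + x ^ (N - 1) * \<phi>'' x
          = x ^ (N - 1) * (\<phi>'' x + real (N - 1) * (\<phi>' x / x))"
        by (simp add: field_simps)
      also have "\<dots> > 0" using S1_pos[OF that] that by simp
      finally show "real (N - 1) * x ^ (N - 1 - 1) * \<phi>' x + x ^ (N - 1) * \<phi>'' x > 0" .
    qed
  qed
  then show ?thesis using that by (simp add: deriv_0 zero_less_mult_iff)
qed

lemma \<phi>_mono: "0 \<le> r \<Longrightarrow> r \<le> s \<Longrightarrow> \<phi> r \<le> \<phi> s"
proof (rule DERIV_nonneg_imp_nondecreasing[where f = \<phi>])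
  show "\<exists>y. (\<phi> has_real_derivative y) (at x) \<and> y \<ge> 0" if "0 \<le> r" "r \<le> x" for x
    using that deriv[of x] \<phi>'_pos[of x] deriv_0 by (intro exI[of _ "\<phi>' x"]) (cases "x = 0"; auto)
qed

text \<open>Multiplying the equation by c r^(N-1) reproduces the product rule: the coefficients N -
  k and k match through binom(N-1,k) k = (N - k) C.\<close>

lemma flux_deriv:
  assumes "r > 0"
  shows "((\<lambda>r. r ^ (N - k) * \<phi>' r ^ k) has_real_derivative c * r ^ (N - 1) * (p r * h (\<phi> r)) ^ k) (at r)"
proof -
  have "((\<lambda>r. r ^ (N - k) * \<phi>' r ^ k) has_real_derivative
      real (N - k) * r ^ (N - k - 1) * \<phi>' r ^ k + r ^ (N - k) * (real k * \<phi>' r ^ (k - 1) * \<phi>'' r)) (at r)"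
    by (auto intro!: derivative_eq_intros deriv2)
  moreover have "real (N - k) * r ^ (N - k - 1) * \<phi>' r ^ k + r ^ (N - k) * (real k * \<phi>' r ^ (k - 1) * \<phi>'' r)
      = c * r ^ (N - 1) * (p r * h (\<phi> r)) ^ k"
  proof -
    have 1: "real (N - k) * r ^ (N - k - 1) = (real N - real k) * r ^ (N - k) / r"
      using assms k_le_N by (cases "N - k") (auto simp: of_nat_diff)
    have 2: "r ^ (N - 1) = r ^ (N - k) * r ^ (k - 1)"
      using k_pos k_le_N by (simp flip: power_add)
    have 3: "r ^ (k - 1) * (\<phi>' r / r) ^ (k - 1) = \<phi>' r ^ (k - 1)"
      using assms by (simp add: power_divide)
    have 4: "r ^ (k - 1) * (\<phi>' r / r) ^ k = \<phi>' r ^ k / r"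
      using assms power_minus_mult[of k r] k_pos by (simp add: power_divide field_simps)
    have 5: "real ((N - 1) choose k) = (real N - real k) * C / real k"
      using choose_N k_pos by (simp add: field_simps)
    have "c * r ^ (N - 1) * (p r * h (\<phi> r)) ^ k
        = c * r ^ (N - k) * (C * \<phi>'' r * (r ^ (k - 1) * (\<phi>' r / r) ^ (k - 1))
          + real ((N - 1) choose k) * (r ^ (k - 1) * (\<phi>' r / r) ^ k))"
      unfolding equation[OF assms, symmetric] 2 by (simp add: algebra_simps)
    also have "\<dots> = c * r ^ (N - k) * (C * \<phi>'' r * \<phi>' r ^ (k - 1)
          + (real N - real k) * C / real k * (\<phi>' r ^ k / r))"
      unfolding 3 4 5 ..
    also have "\<dots> = (real N - real k) * r ^ (N - k) / r * \<phi>' r ^ k + r ^ (N - k) * (real k * \<phi>' r ^ (k - 1) * \<phi>'' r)"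
      using C_pos k_pos assms by (simp add: c_def field_simps)
    finally show ?thesis unfolding 1 by simp
  qed
  ultimately show ?thesis by simp
qed

text \<open>Monotonicity gives h(\<phi>(s)) \<ge> h(\<phi>(0)), so this constant can be taken out of
  the integrated flux equation.\<close>

lemma \<phi>'_lower_bound:
  assumes "r > 0"
  shows "h (\<phi> 0) * root k (real k / r ^ (N - k) * integral {0..r} (\<lambda>s. s ^ (N - 1) / C * p s ^ k)) \<le> \<phi>' r"
proof -
  let ?J = "\<lambda>t. integral {0..t} (\<lambda>s. s ^ (N - 1) / C * p s ^ k)"
  have cont: "continuous_on {0..} (\<lambda>s. s ^ (N - 1) / C * p s ^ k)"
    using C_pos by (intro continuous_intros cont_p) auto
  have "0 ^ (N - k) * \<phi>' 0 ^ k - h (\<phi> 0) ^ k * real k * ?J 0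
      \<le> r ^ (N - k) * \<phi>' r ^ k - h (\<phi> 0) ^ k * real k * ?J r"
  proof (rule DERIV_nonneg_imp_increasing_open[where f = "\<lambda>r. r ^ (N - k) * \<phi>' r ^ k - h (\<phi> 0) ^ k * real k * ?J r"])
    show "continuous_on {0..r} (\<lambda>r. r ^ (N - k) * \<phi>' r ^ k - h (\<phi> 0) ^ k * real k * ?J r)"
      by (intro continuous_intros cont_\<phi>' continuous_on_subset[OF continuous_on_integral_atLeast[OF cont]]) auto
    show "\<exists>d. ((\<lambda>r. r ^ (N - k) * \<phi>' r ^ k - h (\<phi> 0) ^ k * real k * ?J r) has_real_derivative d) (at x) \<and> d \<ge> 0"
      if "0 < x" for x
    proof (intro exI conjI)
      show "((\<lambda>r. r ^ (N - k) * \<phi>' r ^ k - h (\<phi> 0) ^ k * real k * ?J r) has_real_derivative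
          c * x ^ (N - 1) * (p x * h (\<phi> x)) ^ k - h (\<phi> 0) ^ k * real k * (x ^ (N - 1) / C * p x ^ k)) (at x)"
        using that by (intro DERIV_diff DERIV_cmult flux_deriv integral_has_real_derivative_at[OF cont])
      have "h (\<phi> 0) ^ k \<le> h (\<phi> x) ^ k"
        using \<phi>_pos[of 0] \<phi>_mono[of 0 x] that h_nonneg[of "\<phi> 0"]
        by (intro power_mono mono_onD[OF mono_h]) auto
      then have "c * x ^ (N - 1) * p x ^ k * h (\<phi> 0) ^ k \<le> c * x ^ (N - 1) * p x ^ k * h (\<phi> x) ^ k"
        using c_pos that p_pos[of x] by (intro mult_left_mono) auto
      then show "0 \<le> c * x ^ (N - 1) * (p x * h (\<phi> x)) ^ k - h (\<phi> 0) ^ k * real k * (x ^ (N - 1) / C * p x ^ k)"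
        by (simp add: c_def power_mult_distrib mult_ac)
    qed
  qed (use assms in auto)
  then have "h (\<phi> 0) ^ k * real k * ?J r \<le> r ^ (N - k) * \<phi>' r ^ k"
    using k_pos by (simp add: deriv_0 power_0_left)
  then have "h (\<phi> 0) ^ k * (real k / r ^ (N - k) * j) \<le> \<phi>' r ^ k" if "j = ?J r" for j
    unfolding that[symmetric] using assms by (simp add: field_simps)
  then have "root k (h (\<phi> 0) ^ k * (real k / r ^ (N - k) * ?J r)) \<le> root k (\<phi>' r ^ k)"
    using k_pos by (intro real_root_le_mono) auto
  moreover have "root k (h (\<phi> 0) ^ k * x) = h (\<phi> 0) * root k x" for x
    using k_pos h_nonneg[of "\<phi> 0"] \<phi>_pos[of 0] by (simp add: real_root_mult real_root_power_cancel)
  moreover have "root k (\<phi>' r ^ k) = \<phi>' r"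
    using k_pos \<phi>'_pos[OF assms] by (simp add: real_root_power_cancel)
  ultimately show ?thesis by (simp only:)
qed

text \<open>By the lower bound, \<phi> / h(\<phi>(0)) grows at least as fast as a primitive of the
  integrand, so a bound on \<phi> would make the integral finite.\<close>

lemma \<phi>_unbounded:
  assumes "(\<integral>\<^sup>+ t\<in>{0..}. ennreal (root k (real k / t ^ (N - k) *
      integral {0..t} (\<lambda>s. s ^ (N - 1) / C * p s ^ k))) \<partial>lborel) = \<infinity>"
  shows "\<exists>r\<ge>0. \<phi> r > B"
proof (rule ccontr)
  assume "\<not> (\<exists>r\<ge>0. \<phi> r > B)"
  then have B: "\<phi> r \<le> B" if "r \<ge> 0" for r using that by force
  let ?J = "\<lambda>t. integral {0..t} (\<lambda>s. s ^ (N - 1) / C * p s ^ k)"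
  have cont: "continuous_on {0..} (\<lambda>s. s ^ (N - 1) / C * p s ^ k)"
    using C_pos by (intro continuous_intros cont_p) auto
  have h0: "h (\<phi> 0) > 0" using h_pos \<phi>_pos by simp
  have "(\<integral>\<^sup>+ t\<in>{0..}. ennreal (root k (real k / t ^ (N - k) * ?J t)) \<partial>lborel)
      \<le> ennreal (B / h (\<phi> 0) - \<phi> 0 / h (\<phi> 0))"
  proof (rule nn_integral_atLeast_le_of_bounded_primitive[where F = "\<lambda>t. \<phi> t / h (\<phi> 0)" and d = "\<lambda>t. \<phi>' t / h (\<phi> 0)"])
    show "continuous_on {0<..} (\<lambda>t. root k (real k / t ^ (N - k) * ?J t))"
      by (intro continuous_intros continuous_on_subset[OF continuous_on_integral_atLeast[OF cont]]) auto
    show "0 \<le> root k (real k / x ^ (N - k) * ?J x)" if "0 < x" for x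
    proof -
      have "?J x \<ge> 0"
        by (rule integral_nonneg[OF integrable_continuous_real[OF continuous_on_subset[OF cont]]])
          (use C_pos p_pos in \<open>auto simp: less_imp_le\<close>)
      then show ?thesis
        using that k_pos by (intro real_root_ge_zero mult_nonneg_nonneg divide_nonneg_nonneg) auto
    qed
    show "continuous_on {0..} (\<lambda>t. \<phi> t / h (\<phi> 0))"
      using h0 by (intro continuous_intros cont_\<phi>) auto
    show "((\<lambda>t. \<phi> t / h (\<phi> 0)) has_real_derivative \<phi>' x / h (\<phi> 0)) (at x)" for x
      by (intro DERIV_cdivide deriv)
    show "root k (real k / x ^ (N - k) * ?J x) \<le> \<phi>' x / h (\<phi> 0)" if "0 < x" for x
      using \<phi>'_lower_bound[OF that] h0 by (simp add: field_simps)
    show "\<phi> x / h (\<phi> 0) \<le> B / h (\<phi> 0)" if "0 \<le> x" for x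
      using B[OF that] h0 by (simp add: divide_right_mono)
  qed
  then show False using assms by (simp add: top_unique)
qed

text \<open>The weight \<open>m(r) = r\<^bsup>N+N/k-2\<^esup> p(r)\<^sup>k\<close> is the factor that appears when \<open>(V\<^bsup>(k+1)/k\<^esup>)'\<close>,
  \<open>V = r\<^bsup>N-k\<^esup> \<phi>'\<^sup>k\<close>, is written as a multiple of \<open>(H(\<phi>))'\<close>.\<close>

lemma \<phi>'_upper_bound:
  fixes m :: "real \<Rightarrow> real"
  defines "m \<equiv> \<lambda>r. r powr (real N + real N / real k - 2) * p r ^ k"
  assumes "R > 0" "mono_on {R..} m"
  obtains A B where "A \<ge> 0" "B \<ge> 0" "\<And>r. r \<ge> R \<Longrightarrow>
    \<phi>' r \<le> (A * r powr (1 - real N / real k)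
      + B * (r powr ((real k - 1) / (real k + 1)) * p r powr (real k / (real k + 1)))) * w (\<phi> r)"
proof -
  define K where "K = (real k + 1) / C"
  have K_pos: "K > 0" using C_pos by (simp add: K_def)
  \<comment> \<open>The weight makes this the power (k+1)/k of the flux r^(N-k) \<phi>'^k, as
    \<open>W_eq\<close> records.\<close>
  define W where "W r = (r powr (real N / real k - 1) * \<phi>' r) ^ (k + 1)" for r
  have V_powr: "(r ^ (N - k) * \<phi>' r ^ k) powr (1 / real k) = r powr (real N / real k - 1) * \<phi>' r" if "r > 0" for r
  proof -
    have "r ^ (N - k) = r powr (real N - real k)" "\<phi>' r ^ k = \<phi>' r powr real k"
      using that \<phi>'_pos[OF that] k_le_N by (simp_all add: powr_realpow flip: of_nat_diff)
    moreover have "(real N - real k) * (1 / real k) = real N / real k - 1"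
      using k_pos by (simp add: field_simps)
    ultimately show ?thesis
      using that \<phi>'_pos[OF that] k_pos by (simp add: powr_mult powr_powr)
  qed
  have W_eq: "W r = (r ^ (N - k) * \<phi>' r ^ k) powr (1 / real k + 1)" if "r > 0" for r
  proof -
    let ?V = "r ^ (N - k) * \<phi>' r ^ k"
    have V: "?V > 0" using that \<phi>'_pos[OF that] by simp
    have "W r = (?V powr (1 / real k)) ^ (k + 1)" unfolding W_def V_powr[OF that] ..
    also have "\<dots> = ?V powr (1 / real k * real (k + 1))"
      using V powr_realpow[of "?V powr (1 / real k)" "k + 1"] by (simp only: powr_powr powr_gt_zero)
    also have "1 / real k * real (k + 1) = 1 / real k + 1" using k_pos by (simp add: field_simps)
    finally show ?thesis .
  qed
  have W_deriv: "(W has_real_derivative K * m r * (h (\<phi> r) ^ k * \<phi>' r)) (at r)" if "r > 0" for r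
  proof (rule has_field_derivative_transform_within_open[where S = "{0<..}"])
    let ?V = "\<lambda>r. r ^ (N - k) * \<phi>' r ^ k"
    let ?V' = "c * r ^ (N - 1) * (p r * h (\<phi> r)) ^ k"
    have V: "?V r > 0" using that \<phi>'_pos[OF that] by simp
    have "((\<lambda>r. ?V r powr (1 / real k + 1)) has_real_derivative
        (1 / real k + 1) * ?V r powr (1 / real k + 1 - of_nat 1) * ?V') (at r)"
      by (rule DERIV_fun_powr[OF flux_deriv[OF that] V])
    moreover have "(1 / real k + 1) * ?V r powr (1 / real k + 1 - of_nat 1) * ?V' = K * m r * (h (\<phi> r) ^ k * \<phi>' r)"
    proof -
      have "r ^ (N - 1) = r powr (real N - 1)"
        using that N_pos powr_realpow[OF that, of "N - 1"] by (simp add: of_nat_diff)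
      then have 1: "r powr (real N / real k - 1) * r ^ (N - 1) = r powr (real N + real N / real k - 2)"
        by (simp flip: powr_add) (simp add: algebra_simps)
      have "(1 / real k + 1) * ?V r powr (1 / real k + 1 - of_nat 1) * ?V'
          = (1 / real k + 1) * (r powr (real N / real k - 1) * \<phi>' r) * ?V'"
        using V_powr[OF that] by simp
      also have "\<dots> = (1 / real k + 1) * c * (r powr (real N / real k - 1) * r ^ (N - 1)) * p r ^ k * (h (\<phi> r) ^ k * \<phi>' r)"
        by (simp add: power_mult_distrib)
      also have "(1 / real k + 1) * c = K"
        using k_pos C_pos by (simp add: K_def c_def field_simps)
      finally show ?thesis unfolding 1 m_def by (simp add: mult.assoc)
    qed
    ultimately show "((\<lambda>r. ?V r powr (1 / real k + 1)) has_real_derivative K * m r * (h (\<phi> r) ^ k * \<phi>' r)) (at r)"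
      by simp
  qed (use that W_eq in auto)
  \<comment> \<open>For fixed r, m(s) \<le> m(r) on [R,r] allows the weight to be frozen at r; the
    right side then integrates to a multiple of H(\<phi>).\<close>
  have W_le: "W r \<le> W R + K * m r * H (\<phi> r)" if "r \<ge> R" for r
  proof -
    have r: "r > 0" using that assms(2) by simp
    have "K * m r * H (\<phi> R) - W R \<le> K * m r * H (\<phi> r) - W r"
    proof (rule DERIV_nonneg_imp_nondecreasing[OF that, where f = "\<lambda>s. K * m r * H (\<phi> s) - W s"])
      fix s assume s: "R \<le> s" "s \<le> r"
      then have "s > 0" using assms(2) by simp
      have "((\<lambda>s. K * m r * H (\<phi> s) - W s) has_real_derivative
          K * m r * (h (\<phi> s) ^ k * \<phi>' s) - K * m s * (h (\<phi> s) ^ k * \<phi>' s)) (at s)"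
        using \<open>s > 0\<close> \<phi>_pos[of s]
        by (intro DERIV_diff DERIV_cmult DERIV_chain2[OF H_deriv deriv] W_deriv) auto
      moreover have "K * m s * (h (\<phi> s) ^ k * \<phi>' s) \<le> K * m r * (h (\<phi> s) ^ k * \<phi>' s)"
        using mono_onD[OF assms(3), of s r] s K_pos \<open>s > 0\<close> \<phi>'_pos[of s] h_nonneg[of "\<phi> s"] \<phi>_pos[of s]
        by (intro mult_right_mono mult_left_mono) auto
      ultimately show "\<exists>y. ((\<lambda>s. K * m r * H (\<phi> s) - W s) has_real_derivative y) (at s) \<and> y \<ge> 0"
        by (metis diff_ge_0_iff_ge)
    qed
    moreover have "0 \<le> K * m r * H (\<phi> R)"
      using K_pos p_pos[of r] r H_pos[of "\<phi> R"] \<phi>_pos[of R] assms(2) by (simp add: m_def)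
    ultimately show ?thesis by simp
  qed
  \<comment> \<open>\<open>A\<close> turns the boundary term W(R) into a multiple of w(\<phi>(r)),
    by w(\<phi>(R)) \<le> w(\<phi>(r)); \<open>B\<close> compensates the factor k + 1 inside
    \<open>w\<close>.\<close>
  define A where "A = root (k + 1) (W R) / w (\<phi> R)"
  define B where "B = root (k + 1) (K / (real k + 1))"
  have WR: "W R \<ge> 0" using \<phi>'_pos[OF assms(2)] by (simp add: W_def)
  have wR: "w (\<phi> R) > 0" using assms(2) by (intro w_pos \<phi>_pos) auto
  have A_nonneg: "A \<ge> 0" using WR wR by (simp add: A_def)
  have B_nonneg: "B \<ge> 0" using K_pos by (simp add: B_def)
  have "\<phi>' r \<le> (A * r powr (1 - real N / real k)
      + B * (r powr ((real k - 1) / (real k + 1)) * p r powr (real k / (real k + 1)))) * w (\<phi> r)" if "r \<ge> R" for r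
  proof -
    have r: "r > 0" using that assms(2) by simp
    have pr: "p r > 0" using p_pos r by simp
    have w_r: "w (\<phi> r) > 0" using r by (intro w_pos \<phi>_pos) auto
    define a where "a = A * r powr (1 - real N / real k) * w (\<phi> r)"
    define b where "b = B * (r powr ((real k - 1) / (real k + 1)) * p r powr (real k / (real k + 1))) * w (\<phi> r)"
    have ab: "a \<ge> 0" "b \<ge> 0" using A_nonneg B_nonneg w_r by (simp_all add: a_def b_def)
    let ?q = "r powr (1 - real N / real k)"
    have q: "?q * r powr (real N / real k - 1) = 1"
      using r by (simp flip: powr_add)
    have "\<phi>' r ^ (k + 1) = ?q ^ (k + 1) * W r"
      unfolding W_def power_mult_distrib[symmetric] mult.assoc[symmetric] q by simp
    also have "\<dots> \<le> ?q ^ (k + 1) * (W R + K * m r * H (\<phi> r))"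
      using W_le[OF that] by (intro mult_left_mono) auto
    also have "\<dots> = ?q ^ (k + 1) * W R + ?q ^ (k + 1) * (K * m r * H (\<phi> r))"
      by (rule distrib_left)
    also have "?q ^ (k + 1) * W R \<le> a ^ (k + 1)"
    proof -
      have "w (\<phi> R) \<le> w (\<phi> r)"
        unfolding w_def using \<phi>_mono[of R r] that assms(2) \<phi>_pos[of R]
        by (intro real_root_le_mono mult_left_mono H_mono) auto
      then have "root (k + 1) (W R) \<le> A * w (\<phi> r)"
        using wR mult_left_mono[of "w (\<phi> R)" "w (\<phi> r)" "root (k + 1) (W R)"] WR
        by (simp add: A_def pos_le_divide_eq)
      then have "root (k + 1) (W R) ^ (k + 1) \<le> (A * w (\<phi> r)) ^ (k + 1)"
        using WR by (intro power_mono) auto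
      moreover have "root (k + 1) (W R) ^ (k + 1) = W R"
        using WR by (intro real_root_pow_pos2) auto
      ultimately have "?q ^ (k + 1) * W R \<le> ?q ^ (k + 1) * (A * w (\<phi> r)) ^ (k + 1)"
        by (intro mult_left_mono) auto
      then show ?thesis by (simp add: a_def power_mult_distrib mult_ac)
    qed
    also have "?q ^ (k + 1) * (K * m r * H (\<phi> r)) = b ^ (k + 1)"
    proof -
      have powr_pow: "(x powr e) ^ (k + 1) = x powr (e * (real k + 1))" if "x > 0" for x e :: real
        using that powr_realpow[of "x powr e" "k + 1"] by (simp add: powr_powr add.commute)
      have "B ^ (k + 1) = K / (real k + 1)"
        unfolding B_def using K_pos by (intro real_root_pow_pos2) auto
      moreover have "w (\<phi> r) ^ (k + 1) = (real k + 1) * H (\<phi> r)"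
        unfolding w_def using H_pos[of "\<phi> r"] \<phi>_pos[of r] r by (intro real_root_pow_pos2) auto
      moreover have "(r powr ((real k - 1) / (real k + 1))) ^ (k + 1) = r powr (real k - 1)"
        unfolding powr_pow[OF r] by simp
      moreover have "(p r powr (real k / (real k + 1))) ^ (k + 1) = p r ^ k"
        unfolding powr_pow[OF pr] using pr by (simp add: powr_realpow)
      ultimately have "b ^ (k + 1) = K / (real k + 1) * (r powr (real k - 1) * p r ^ k) * ((real k + 1) * H (\<phi> r))"
        unfolding b_def power_mult_distrib by simp
      also have "\<dots> = K * (r powr (real k - 1) * p r ^ k) * H (\<phi> r)"
        by simp
      \<comment> \<open>With x = N/k the exponent (1 - x)(k + 1) + x k + x - 2 no longer depends on
        x.\<close>
      also have "r powr (real k - 1) = ?q ^ (k + 1) * r powr (real N + real N / real k - 2)"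
      proof -
        have "(1 - x) * (real k + 1) + (x * real k + x - 2) = real k - 1" for x
          by (simp add: algebra_simps)
        from this[of "real N / real k"]
        have "(1 - real N / real k) * (real k + 1) + (real N + real N / real k - 2) = real k - 1"
          using k_pos by simp
        then show ?thesis unfolding powr_pow[OF r] powr_add[symmetric] by (simp only:)
      qed
      finally show ?thesis by (simp add: m_def)
    qed
    finally have "\<phi>' r ^ (k + 1) \<le> a ^ (k + 1) + b ^ (k + 1)" by simp
    also have "\<dots> \<le> (a + b) ^ (k + 1)"
      using power_Suc_superadditive[OF ab, of k] by simp
    finally have "\<phi>' r \<le> a + b"
      using ab power_le_imp_le_base[of "\<phi>' r" k "a + b"] by simp
    then show ?thesis by (simp add: a_def b_def algebra_simps)
  qed
  then show thesis using that A_nonneg B_nonneg by blast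
qed

lemma \<phi>_bounded:
  assumes "2 * k < N" "R > 0" "\<epsilon> > 0"
    and mono: "mono_on {R..} (\<lambda>r. r powr (real N + real N / real k - 2) * p r ^ k)"
    and fin: "(\<integral>\<^sup>+ t\<in>{0..}. ennreal (t powr (1 + \<epsilon> + 2 * (real k - 1) / (real k + 1)) *
      p t powr (2 * real k / (real k + 1))) \<partial>lborel) \<noteq> \<infinity>"
  shows "\<exists>Z. \<forall>r\<ge>0. \<phi> r \<le> Z"
proof (cases "\<exists>r\<ge>R. \<phi> r \<ge> 1")
  \<comment> \<open>A profile staying below 1 on {R..} is bounded by monotonicity. Otherwise the
    comparison starts where 1 is reached, since \<open>G_compare\<close> asks for values at least
    1.\<close>
  case False
  then have "\<phi> r \<le> 1" if "r \<ge> 0" for r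
    using \<phi>_mono[of r "max r R"] that by (metis max.cobounded1 max.cobounded2 linorder_not_le order.strict_implies_order order_trans)
  then show ?thesis by blast
next
  case True
  then obtain R1 where R1: "R1 \<ge> R" "\<phi> R1 \<ge> 1" by blast
  then have R1_pos: "R1 > 0" using assms(2) by simp
  obtain A B where AB: "A \<ge> 0" "B \<ge> 0" "\<And>r. r \<ge> R \<Longrightarrow>
    \<phi>' r \<le> (A * r powr (1 - real N / real k)
      + B * (r powr ((real k - 1) / (real k + 1)) * p r powr (real k / (real k + 1)))) * w (\<phi> r)"
    using \<phi>'_upper_bound[OF assms(2) mono] by blast
  define I where "I t = t powr (1 + \<epsilon> + 2 * (real k - 1) / (real k + 1)) * p t powr (2 * real k / (real k + 1))" for t
  define T where "T = enn2real (\<integral>\<^sup>+ t\<in>{0..}. ennreal (I t) \<partial>lborel)"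
  \<comment> \<open>With this \<alpha> > 0 the exponent 1 - N/k is -\<alpha> - 1, which is
    integrable at infinity.\<close>
  define \<alpha> where "\<alpha> = real N / real k - 2"
  have \<alpha>: "\<alpha> > 0"
    using assms(1) k_pos by (simp add: \<alpha>_def field_simps flip: of_nat_mult of_nat_less_iff)
  have cont_I: "continuous_on {R1..} I"
    unfolding I_def[abs_def] using R1_pos p_pos
    by (intro continuous_intros continuous_on_subset[OF cont_p]) (auto simp: less_imp_neq[symmetric])
  have I_nonneg: "I t \<ge> 0" for t by (simp add: I_def)
  have I_le: "integral {R1..r} I \<le> T" for r
  proof -
    have "ennreal (integral {R1..r} I) \<le> (\<integral>\<^sup>+ t\<in>{0..}. ennreal (I t) \<partial>lborel)"
      using I_nonneg R1_pos
      by (intro ennreal_integral_le_nn_integral continuous_on_subset[OF cont_I]) auto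
    also have "\<dots> = ennreal T"
      using fin unfolding T_def I_def by (intro ennreal_enn2real[symmetric]) (simp add: less_top)
    finally show ?thesis
      by (subst (asm) ennreal_le_iff) (simp_all add: T_def)
  qed
  \<comment> \<open>\<open>q\<close> bounds \<phi>' / w(\<phi>) once the p-term is split by AM-GM,
    and \<open>Q\<close> is its explicit primitive.\<close>
  define q where "q r = A * r powr (- \<alpha> - 1) + B * (I r + r powr (- \<epsilon> - 1))" for r
  define Q where "Q r = A * (r powr (- \<alpha>) / (- \<alpha>)) + B * (integral {R1..r} I + r powr (- \<epsilon>) / (- \<epsilon>))" for r
  have \<phi>'_le: "\<phi>' r \<le> q r * w (\<phi> r)" if "r \<ge> R1" for r
  proof -
    have r: "r > 0" using that R1_pos by simp
    define z where "z = r powr ((real k - 1) / (real k + 1)) * p r powr (real k / (real k + 1))"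
    \<comment> \<open>The factor r^((1+\<epsilon>)/2) and its inverse are inserted so that z = x y
      with x^2 = I(r) and y^2 = r^(-\<epsilon>-1).\<close>
    define x where "x = r powr ((1 + \<epsilon>) / 2) * z"
    define y where "y = r powr (- (1 + \<epsilon>) / 2)"
    have "r powr ((1 + \<epsilon>) / 2) * r powr (- (1 + \<epsilon>) / 2) = 1"
      unfolding powr_add[symmetric] using r by (simp flip: add_divide_distrib minus_add_distrib)
    then have "z = x * y"
      unfolding x_def y_def by (metis mult.commute mult.left_commute mult.right_neutral)
    also have "\<dots> \<le> x\<^sup>2 + y\<^sup>2"
      using sum_squares_bound[of x y] zero_le_power2[of x] zero_le_power2[of y] by linarith
    also have "x\<^sup>2 = I r"
    proof -
      have "(r powr ((1 + \<epsilon>) / 2))\<^sup>2 = r powr (1 + \<epsilon>)"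
        "(r powr ((real k - 1) / (real k + 1)))\<^sup>2 = r powr (2 * (real k - 1) / (real k + 1))"
        "(p r powr (real k / (real k + 1)))\<^sup>2 = p r powr (2 * real k / (real k + 1))"
        by (simp_all add: power2_eq_square add_divide_distrib flip: powr_add)
      then show ?thesis
        by (simp add: x_def z_def I_def power_mult_distrib powr_add)
    qed
    also have "y\<^sup>2 = r powr (- \<epsilon> - 1)"
    proof -
      have "- (1 + \<epsilon>) / 2 + - (1 + \<epsilon>) / 2 = - \<epsilon> - 1" by simp
      then show ?thesis unfolding y_def power2_eq_square powr_add[symmetric] by (simp only:)
    qed
    finally have "B * z \<le> B * (I r + r powr (- \<epsilon> - 1))"
      using AB(2) by (rule mult_left_mono)
    moreover have e: "1 - real N / real k = - \<alpha> - 1" by (simp add: \<alpha>_def)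
    moreover have "w (\<phi> r) > 0" using r by (intro w_pos \<phi>_pos) simp
    ultimately have "(A * r powr (1 - real N / real k) + B * z) * w (\<phi> r) \<le> q r * w (\<phi> r)"
      unfolding q_def e by (intro mult_right_mono) auto
    then show ?thesis using AB(3)[of r] that R1(1) by (simp add: z_def)
  qed
  have Q_deriv: "(Q has_real_derivative q r) (at r)" if "r > R1" for r
  proof -
    have r: "r > 0" using that R1_pos by simp
    have *: "((\<lambda>r. r powr (- b) / (- b)) has_real_derivative r powr (- b - 1)) (at r)" if "b > 0" for b :: real
      using DERIV_cdivide[OF DERIV_powr[OF DERIV_ident r DERIV_const[of "- b"]], of "- b"] that r
      by (simp add: powr_diff)
    show ?thesis
      unfolding Q_def[abs_def] q_def
      by (intro DERIV_add DERIV_cmult * \<alpha> assms(3) integral_has_real_derivative_at[OF cont_I that])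
  qed
  have cont_Q: "continuous_on {R1..} Q"
    unfolding Q_def[abs_def] using R1_pos \<alpha> assms(3)
    by (intro continuous_intros continuous_on_integral_atLeast[OF cont_I]) auto
  define Z where "Z = G (\<phi> R1) + B * T - Q R1"
  have G_le: "G (\<phi> r) \<le> Z" if "r \<ge> R1" for r
  proof -
    have "G (\<phi> r) - G (\<phi> R1) \<le> Q r - Q R1"
    proof (rule G_compare[OF that, where y = \<phi> and y' = \<phi>' and Q = Q and q = q])
      show "continuous_on {R1..r} Q" by (rule continuous_on_subset[OF cont_Q]) auto
      show "\<phi> t \<ge> 1" if "t \<in> {R1..r}" for t
        using \<phi>_mono[of R1 t] that R1 R1_pos by auto
    qed (use cont_\<phi> deriv Q_deriv \<phi>'_le in auto)
    \<comment> \<open>The pure powers in \<open>Q\<close> have negative denominators and only lower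
      it.\<close>
    moreover have "Q r \<le> B * T"
    proof -
      have "A * (r powr (- \<alpha>) / (- \<alpha>)) \<le> 0" "r powr (- \<epsilon>) / (- \<epsilon>) \<le> 0"
        using AB(1) \<alpha> assms(3) by (simp_all add: mult_nonneg_nonneg)
      moreover from this(2) have "B * (integral {R1..r} I + r powr (- \<epsilon>) / (- \<epsilon>)) \<le> B * T"
        using I_le[of r] AB(2) by (intro mult_left_mono) auto
      ultimately show ?thesis unfolding Q_def by linarith
    qed
    ultimately show ?thesis by (simp add: Z_def)
  qed
  obtain v where v: "v \<ge> 1" "G v > Z" using G_unbounded by blast
  have "\<phi> r \<le> v" if "r \<ge> 0" for r
  proof (rule ccontr)
    assume "\<not> \<phi> r \<le> v"
    then have "v \<le> \<phi> (max r R1)" using \<phi>_mono[of r "max r R1"] that by linarith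
    then have "G v \<le> G (\<phi> (max r R1))" using v(1) by (intro G_mono)
    then show False using v(2) G_le[of "max r R1"] by simp
  qed
  then show ?thesis by blast
qed

end

section \<open>From admissible solutions to profiles, and the three assertions\<close>

lemma (in hessian_ode) admissible_radial_solution_profile:
  fixes u :: "real^'n \<Rightarrow> real"
  assumes N: "N = CARD('n)" and "h 0 = 0" and u: "u \<in> admissible k" "\<And>x. u x \<ge> 0" "radial u" "solves_hessian_eq k p h u"
  obtains \<phi> \<phi>' \<phi>'' where "\<And>x. u x = \<phi> (norm x)" "hessian_solution k h H N p \<phi> \<phi>' \<phi>''"
proof -
  have C2: "C2_fun u" using u(1) by (simp add: admissible_def)
  obtain \<phi> \<phi>' \<phi>'' where \<phi>: "\<And>x. u x = \<phi> (norm x)"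
    "\<And>t. (\<phi> has_real_derivative \<phi>' t) (at t)" "\<And>t. (\<phi>' has_real_derivative \<phi>'' t) (at t)"
    "\<phi>' 0 = 0"
    using radial_C2_profile[OF C2 u(3)] by blast
  have S_pos: "elem_sym j (eigenvalues (hessian u x)) > 0" if "1 \<le> j" "j \<le> k" for j x
    using u(1) that by (auto simp: admissible_def garding_cone_def)
  have S_eq: "elem_sym k (eigenvalues (hessian u x)) = (p (norm x) * h (u x)) ^ k" for x
    using u(4) S_pos[OF k_pos order_refl, of x] k_pos
    by (metis solves_hessian_eq_def real_root_pow_pos2 less_imp_le less_le_trans zero_less_one)
  \<comment> \<open>A zero of u would make the right side vanish, by h(0) = 0, against S_k > 0.
    Admissibility thus forces u to be positive everywhere.\<close>
  have u_pos: "u x > 0" for x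
  proof -
    have "u x \<noteq> 0" using S_pos[OF k_pos order_refl, of x] S_eq[of x] assms(2) k_pos by (auto simp: power_0_left)
    then show ?thesis using u(2)[of x] by linarith
  qed
  fix i :: 'n
  have norm_axis: "norm (r *\<^sub>R (axis i 1 :: real^'n)) = r" if "r \<ge> 0" for r
    using that by simp
  note S = elem_sym_hessian_radial[OF \<phi>(1-3), folded N]
  have "hessian_solution k h H N p \<phi> \<phi>' \<phi>''"
  proof
    show "\<phi> r > 0" if "r \<ge> 0" for r
      using u_pos[of "r *\<^sub>R axis i 1"] norm_axis[OF that] by (simp only: \<phi>(1))
    fix r :: real assume r: "r > 0"
    let ?x = "r *\<^sub>R axis i 1 :: real^'n"
    have x: "norm ?x = r" "?x \<noteq> 0" using norm_axis[of r] r by auto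
    show "\<phi>'' r + real (N - 1) * (\<phi>' r / r) > 0"
      using S[OF x(2), of 1] S_pos[OF order_refl k_pos, of ?x] unfolding x(1) by simp
    show "C * \<phi>'' r * (\<phi>' r / r) ^ (k - 1) + real ((N - 1) choose k) * (\<phi>' r / r) ^ k = (p r * h (\<phi> r)) ^ k"
      using S[OF x(2) k_pos] S_eq[of ?x] unfolding x(1) \<phi>(1) C_def by simp
  qed (fact \<phi>)+
  with \<phi>(1) show thesis using that by blast
qed

theorem theorem2:
  fixes N k :: nat and p h H :: "real \<Rightarrow> real"
  assumes "N = CARD('n::finite)" and "N \<ge> 3"
    and "k \<in> {1..N}"
    and "continuous_on {0..} p" and "\<forall>r\<ge>0. p r > 0"
    and "continuous_on {0..} h" and "\<forall>s\<ge>0. h s \<ge> 0"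
    and "mono_on {0..} h" and "h 0 = 0" and "\<forall>s>0. h s > 0"
    and "\<forall>t\<ge>0. H t = integral {0..t} (\<lambda>z. h z ^ k)"
    and "(\<integral>\<^sup>+ t\<in>{1..}. ennreal (1 / root (k + 1) ((real k + 1) * H t)) \<partial>lborel) = \<infinity>"
  shows
    "(\<exists>u :: real^'n \<Rightarrow> real.
        u \<in> admissible k \<and> (\<forall>x. u x \<ge> 0) \<and> (\<exists>x. u x \<noteq> 0) \<and> radial u \<and>
        solves_hessian_eq k p h u) \<and>
     ((\<exists>R>0. mono_on {R..} (\<lambda>r. r powr (real N + real N / real k - 2) * p r ^ k)) \<longrightarrow>
       ((\<integral>\<^sup>+ t\<in>{0..}. ennreal (root k (real k / t ^ (N - k) *
            integral {0..t} (\<lambda>s. s ^ (N - 1) / real ((N - 1) choose (k - 1)) * p s ^ k)))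
          \<partial>lborel) = \<infinity> \<longrightarrow>
        (\<forall>u :: real^'n \<Rightarrow> real.
          u \<in> admissible k \<and> (\<forall>x. u x \<ge> 0) \<and> (\<exists>x. u x \<noteq> 0) \<and> radial u \<and>
          solves_hessian_eq k p h u \<longrightarrow> large u)) \<and>
       ((\<exists>u :: real^'n \<Rightarrow> real.
          u \<in> admissible k \<and> (\<forall>x. u x \<ge> 0) \<and> radial u \<and>
          solves_hessian_eq k p h u \<and> large u) \<longrightarrow>
        (\<forall>\<epsilon>>0. (\<integral>\<^sup>+ t\<in>{0..}. ennreal
            (t powr (1 + \<epsilon> + 2 * (real k - 1) / (real k + 1)) *
             p t powr (2 * real k / (real k + 1))) \<partial>lborel) = \<infinity>) \<or>
        (if odd N then k \<in> {N div 2 + 1..N} else k \<in> {N div 2..N})))"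
proof -
  interpret hessian_ode k h H N p
    by unfold_locales (use assms in auto)
  note profile = admissible_radial_solution_profile[OF assms(1) assms(9)]
  show ?thesis
  proof (intro conjI impI allI)
    obtain u :: "real^'n \<Rightarrow> real" where u: "u \<in> admissible k" "\<And>x. u x \<ge> 1" "radial u" "solves_hessian_eq k p h u"
      using exists_entire_solution[OF assms(1)] by metis
    have "u x \<ge> 0 \<and> u x \<noteq> 0" for x using u(2)[of x] by auto
    then show "\<exists>u :: real^'n \<Rightarrow> real.
        u \<in> admissible k \<and> (\<forall>x. u x \<ge> 0) \<and> (\<exists>x. u x \<noteq> 0) \<and> radial u \<and> solves_hessian_eq k p h u"
      using u by blast
  next
    fix u :: "real^'n \<Rightarrow> real"
    assume inf: "(\<integral>\<^sup>+ t\<in>{0..}. ennreal (root k (real k / t ^ (N - k) *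
            integral {0..t} (\<lambda>s. s ^ (N - 1) / real ((N - 1) choose (k - 1)) * p s ^ k)))
          \<partial>lborel) = \<infinity>"
      and u: "u \<in> admissible k \<and> (\<forall>x. u x \<ge> 0) \<and> (\<exists>x. u x \<noteq> 0) \<and> radial u \<and> solves_hessian_eq k p h u"
    obtain \<phi> \<phi>' \<phi>'' where \<phi>: "\<And>x. u x = \<phi> (norm x)" "hessian_solution k h H N p \<phi> \<phi>' \<phi>''"
      using profile u by blast
    interpret hessian_solution k h H N p \<phi> \<phi>' \<phi>'' by (fact \<phi>(2))
    show "large u"
      unfolding large_def filterlim_at_top eventually_at_infinity
    proof
      fix Z
      obtain r where r: "r \<ge> 0" "\<phi> r > Z" using \<phi>_unbounded inf unfolding C_def by blast
      have "Z \<le> u x" if "r \<le> norm x" for x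
        using \<phi>_mono[OF r(1) that] r(2) by (simp add: \<phi>(1))
      then show "\<exists>b. \<forall>x. b \<le> norm x \<longrightarrow> Z \<le> u x" by blast
    qed
  next
    assume "\<exists>R>0. mono_on {R..} (\<lambda>r. r powr (real N + real N / real k - 2) * p r ^ k)"
    then obtain R where R: "R > 0" "mono_on {R..} (\<lambda>r. r powr (real N + real N / real k - 2) * p r ^ k)"
      by blast
    assume "\<exists>u :: real^'n \<Rightarrow> real.
          u \<in> admissible k \<and> (\<forall>x. u x \<ge> 0) \<and> radial u \<and> solves_hessian_eq k p h u \<and> large u"
    then obtain u :: "real^'n \<Rightarrow> real" where u: "u \<in> admissible k" "\<forall>x. u x \<ge> 0" "radial u"
      "solves_hessian_eq k p h u" "large u" by blast
    then obtain \<phi> \<phi>' \<phi>'' where \<phi>: "\<And>x. u x = \<phi> (norm x)" "hessian_solution k h H N p \<phi> \<phi>' \<phi>''"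
      using profile by blast
    interpret hessian_solution k h H N p \<phi> \<phi>' \<phi>'' by (fact \<phi>(2))
    have unbounded: "\<not> (\<exists>Z. \<forall>r\<ge>0. \<phi> r \<le> Z)"
    proof
      assume "\<exists>Z. \<forall>r\<ge>0. \<phi> r \<le> Z"
      then obtain Z where Z: "\<And>r. r \<ge> 0 \<Longrightarrow> \<phi> r \<le> Z" by blast
      obtain b where b: "\<And>x. b \<le> norm x \<Longrightarrow> Z + 1 \<le> u x"
        using u(5) unfolding large_def filterlim_at_top eventually_at_infinity by blast
      obtain x :: "real^'n" where "norm x = max b 0" using vector_choose_size by (metis max.cobounded2)
      then show False using b[of x] Z[of "norm x"] by (simp add: \<phi>(1))
    qed
    show "(\<forall>\<epsilon>>0. (\<integral>\<^sup>+ t\<in>{0..}. ennreal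
            (t powr (1 + \<epsilon> + 2 * (real k - 1) / (real k + 1)) *
             p t powr (2 * real k / (real k + 1))) \<partial>lborel) = \<infinity>) \<or>
        (if odd N then k \<in> {N div 2 + 1..N} else k \<in> {N div 2..N})"
    proof (cases "2 * k < N")
      case True
      then show ?thesis using \<phi>_bounded[OF True R(1) _ R(2)] unbounded by blast
    next
      case False
      \<comment> \<open>In both parities alternative 2 amounts to 2k \<ge> N, because for odd N the
        even number 2k is then at least N + 1.\<close>
      then have "if odd N then k \<in> {N div 2 + 1..N} else k \<in> {N div 2..N}"
        using k_le_N by (auto elim!: oddE evenE)
      then show ?thesis ..
    qed
  qed
qed

end
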